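(* Let $B$ be a unital $C^*$-algebra with a $*$-isomorphism $\psi:B\to M_n\otimes B$ satisfying $\psi(1)=I_n\otimes 1$. Let $A$ be a maximal abelian $*$-subalgebra of $B$ with $\sigma_1(A)\subset A$ and $\sigma_2(A)\subset A$, let $\phi:A\to\mathbb{C}$ be a unital algebra homomorphism extended to a positive contraction $\phi:B\to\mathbb{C}$, and let $D=\phi_1(A)\subset M_n$. Suppose that $A\cap C$ is maximal abelian in $C$. Then $A\cap C=D^\infty$ and $D$ is maximal abelian in $M_n(\mathbb{C})$.
   Context: $M_n=M_n(\mathbb{C})$, $I_n$ its identity. Define $\psi_0=\mathrm{id}_B$ and recursively $\psi_{m+1}=(\mathrm{id}^{\otimes m}\otimes\psi)\circ\psi_m:B\to M_n^{\otimes(m+1)}\otimes B$. Define $\kappa_m:M_n^{\otimes m}\to B$ by $\kappa_m(x)=\psi_m^{-1}(x\otimes 1)$, and let $C$ be the norm closure of $\bigcup_{m\ge1}\kappa_m(M_n^{\otimes m})$. With $f:B\to M_n\otimes B$, $f(b)=I_n\otimes b$, define for $m\ge1$ the shift $\sigma_m=\psi_m^{-1}\circ(\mathrm{id}^{\otimes(m-1)}\otimes f)\circ\psi_{m-1}:B\to B$. For $m\ge1$ define $\phi_m=(\mathrm{id}^{\otimes m}\otimes\phi)\circ\psi_m:B\to M_n^{\otimes m}$. Let $D^{\otimes m}\subset M_n^{\otimes m}$ be the $m$-fold tensor product of $D$ and $D^\infty$ the norm closure of $\bigcup_{m\ge1}\kappa_m(D^{\otimes m})$. *)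

theory Defs
  imports "HOL-Analysis.Analysis"
begin

text \<open>
  Conventions.  The unital C*-algebra B is a type 'b of class real_normed_algebra_1 and banach
  (a real unital Banach algebra with norm 1 = 1), together with
  cs :: complex => 'b, the unital embedding of the complex scalars (complex scalar
  multiplication is c . x = cs c * x), and st :: 'b => 'b, the involution.
  Matrices in M_n(B) are functions nat => nat => 'b vanishing outside {..<n} x {..<n}.
  Elements of M_n^{(x)m} (x) B are functions on pairs of index lists (multi-indices),
  vanishing outside multi-indices of length m with all entries < n; position k of the
  list is the k-th tensor factor.
\<close>

definition cstar_alg :: "(complex \<Rightarrow> 'b::{real_normed_algebra_1,banach}) \<Rightarrow> ('b \<Rightarrow> 'b) \<Rightarrow> bool" where
  "cstar_alg cs st \<longleftrightarrow>
     cs 1 = 1 \<and>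
     (\<forall>a b. cs (a + b) = cs a + cs b) \<and>
     (\<forall>a b. cs (a * b) = cs a * cs b) \<and>
     (\<forall>r. cs (complex_of_real r) = of_real r) \<and>
     (\<forall>c x. cs c * x = x * cs c) \<and>
     (\<forall>c x. norm (cs c * x) = cmod c * norm x) \<and>
     (\<forall>x. st (st x) = x) \<and>
     (\<forall>x y. st (x + y) = st x + st y) \<and>
     (\<forall>x y. st (x * y) = st y * st x) \<and>
     (\<forall>c x. st (cs c * x) = cs (cnj c) * st x) \<and>
     (\<forall>x. norm (st x * x) = (norm x)\<^sup>2)"

definition star_subalg :: "(complex \<Rightarrow> 'b::real_normed_algebra_1) \<Rightarrow> ('b \<Rightarrow> 'b) \<Rightarrow> 'b set \<Rightarrow> bool" where
  "star_subalg cs st S \<longleftrightarrow> 0 \<in> S \<and> (\<forall>x\<in>S. \<forall>y\<in>S. x + y \<in> S \<and> x * y \<in> S) \<and>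
     (\<forall>c. \<forall>x\<in>S. cs c * x \<in> S) \<and> (\<forall>x\<in>S. st x \<in> S)"

definition abelian_set :: "'b::times set \<Rightarrow> bool" where
  "abelian_set S \<longleftrightarrow> (\<forall>x\<in>S. \<forall>y\<in>S. x * y = y * x)"

definition masa_in :: "(complex \<Rightarrow> 'b::real_normed_algebra_1) \<Rightarrow> ('b \<Rightarrow> 'b) \<Rightarrow> 'b set \<Rightarrow> 'b set \<Rightarrow> bool" where
  "masa_in cs st E S \<longleftrightarrow> S \<subseteq> E \<and> star_subalg cs st S \<and> abelian_set S \<and>
     (\<forall>S'. S \<subseteq> S' \<and> S' \<subseteq> E \<and> star_subalg cs st S' \<and> abelian_set S' \<longrightarrow> S' = S)"

definition mat_car :: "nat \<Rightarrow> (nat \<Rightarrow> nat \<Rightarrow> 'a::zero) set" where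
  "mat_car n = {X. \<forall>i j. (n \<le> i \<or> n \<le> j) \<longrightarrow> X i j = 0}"

definition mmult :: "nat \<Rightarrow> (nat \<Rightarrow> nat \<Rightarrow> 'a::semiring_0) \<Rightarrow> (nat \<Rightarrow> nat \<Rightarrow> 'a) \<Rightarrow> nat \<Rightarrow> nat \<Rightarrow> 'a" where
  "mmult n X Y = (\<lambda>i j. \<Sum>k<n. X i k * Y k j)"

definition mat_id :: "nat \<Rightarrow> nat \<Rightarrow> nat \<Rightarrow> 'a::{zero,one}" where
  "mat_id n = (\<lambda>i j. if i = j \<and> i < n then 1 else 0)"

definition mat_star_subalg :: "nat \<Rightarrow> (nat \<Rightarrow> nat \<Rightarrow> complex) set \<Rightarrow> bool" where
  "mat_star_subalg n S \<longleftrightarrow> S \<subseteq> mat_car n \<and> (\<lambda>i j. 0) \<in> S \<and>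
     (\<forall>X\<in>S. \<forall>Y\<in>S. (\<lambda>i j. X i j + Y i j) \<in> S \<and> mmult n X Y \<in> S) \<and>
     (\<forall>c. \<forall>X\<in>S. (\<lambda>i j. c * X i j) \<in> S) \<and> (\<forall>X\<in>S. (\<lambda>i j. cnj (X j i)) \<in> S)"

definition mat_masa :: "nat \<Rightarrow> (nat \<Rightarrow> nat \<Rightarrow> complex) set \<Rightarrow> bool" where
  "mat_masa n S \<longleftrightarrow> mat_star_subalg n S \<and> (\<forall>X\<in>S. \<forall>Y\<in>S. mmult n X Y = mmult n Y X) \<and>
     (\<forall>S'. S \<subseteq> S' \<and> mat_star_subalg n S' \<and> (\<forall>X\<in>S'. \<forall>Y\<in>S'. mmult n X Y = mmult n Y X)
        \<longrightarrow> S' = S)"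

definition star_iso_Mn :: "(complex \<Rightarrow> 'b::real_normed_algebra_1) \<Rightarrow> ('b \<Rightarrow> 'b) \<Rightarrow> nat \<Rightarrow> ('b \<Rightarrow> nat \<Rightarrow> nat \<Rightarrow> 'b) \<Rightarrow> bool" where
  "star_iso_Mn cs st n \<psi> \<longleftrightarrow>
     (\<forall>x y. \<psi> (x + y) = (\<lambda>i j. \<psi> x i j + \<psi> y i j)) \<and>
     (\<forall>c x. \<psi> (cs c * x) = (\<lambda>i j. cs c * \<psi> x i j)) \<and>
     (\<forall>x y. \<psi> (x * y) = mmult n (\<psi> x) (\<psi> y)) \<and>
     (\<forall>x. \<psi> (st x) = (\<lambda>i j. st (\<psi> x j i))) \<and>
     inj \<psi> \<and> range \<psi> = mat_car n"

definition idx :: "nat \<Rightarrow> nat \<Rightarrow> nat list set" where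
  "idx n m = {is. length is = m \<and> (\<forall>i\<in>set is. i < n)}"

definition tmat_car :: "nat \<Rightarrow> nat \<Rightarrow> (nat list \<Rightarrow> nat list \<Rightarrow> 'a::zero) set" where
  "tmat_car n m = {X. \<forall>is js. X is js \<noteq> 0 \<longrightarrow> is \<in> idx n m \<and> js \<in> idx n m}"

text \<open>psi_m : B -> M_n^{(x)m} (x) B, with psi_0 = id and
  psi_{m+1} = (id^{(x)m} (x) psi) o psi_m (the new tensor factor is the last one).\<close>
fun psi_pow :: "('b::zero \<Rightarrow> nat \<Rightarrow> nat \<Rightarrow> 'b) \<Rightarrow> nat \<Rightarrow> 'b \<Rightarrow> nat list \<Rightarrow> nat list \<Rightarrow> 'b" where
  "psi_pow \<psi> 0 b = (\<lambda>is js. if is = [] \<and> js = [] then b else 0)"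
| "psi_pow \<psi> (Suc m) b = (\<lambda>is js. if is \<noteq> [] \<and> js \<noteq> []
       then \<psi> (psi_pow \<psi> m b (butlast is) (butlast js)) (last is) (last js) else 0)"

definition kappa :: "(complex \<Rightarrow> 'b::zero) \<Rightarrow> ('b \<Rightarrow> nat \<Rightarrow> nat \<Rightarrow> 'b) \<Rightarrow> nat \<Rightarrow> (nat list \<Rightarrow> nat list \<Rightarrow> complex) \<Rightarrow> 'b" where
  "kappa cs \<psi> m x = inv (psi_pow \<psi> m) (\<lambda>is js. cs (x is js))"

definition Calg :: "(complex \<Rightarrow> 'b::real_normed_vector) \<Rightarrow> ('b \<Rightarrow> nat \<Rightarrow> nat \<Rightarrow> 'b) \<Rightarrow> nat \<Rightarrow> 'b set" where
  "Calg cs \<psi> n = closure (\<Union>m\<in>{1..}. kappa cs \<psi> m ` tmat_car n m)"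

text \<open>sigma_m = psi_m^{-1} o (id^{(x)(m-1)} (x) f) o psi_{m-1}, f(b) = I_n (x) b.\<close>
definition shift :: "('b::{zero,one} \<Rightarrow> nat \<Rightarrow> nat \<Rightarrow> 'b) \<Rightarrow> nat \<Rightarrow> nat \<Rightarrow> 'b \<Rightarrow> 'b" where
  "shift \<psi> n m b = inv (psi_pow \<psi> m)
     (\<lambda>is js. if is \<noteq> [] \<and> js \<noteq> [] \<and> last is = last js \<and> last is < n
              then psi_pow \<psi> (m - 1) b (butlast is) (butlast js) else 0)"

definition phi_pow :: "('b \<Rightarrow> complex) \<Rightarrow> ('b::zero \<Rightarrow> nat \<Rightarrow> nat \<Rightarrow> 'b) \<Rightarrow> nat \<Rightarrow> 'b \<Rightarrow> nat list \<Rightarrow> nat list \<Rightarrow> complex" where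
  "phi_pow \<phi> \<psi> m b = (\<lambda>is js. \<phi> (psi_pow \<psi> m b is js))"

definition elem_tensor :: "nat \<Rightarrow> (nat \<Rightarrow> nat \<Rightarrow> nat \<Rightarrow> complex) \<Rightarrow> nat list \<Rightarrow> nat list \<Rightarrow> complex" where
  "elem_tensor m xs = (\<lambda>is js. if length is = m \<and> length js = m
       then (\<Prod>l<m. xs l (is ! l) (js ! l)) else 0)"

definition tensor_pow :: "nat \<Rightarrow> (nat \<Rightarrow> nat \<Rightarrow> complex) set \<Rightarrow> (nat list \<Rightarrow> nat list \<Rightarrow> complex) set" where
  "tensor_pow m D = {(\<lambda>is js. \<Sum>k<N. c k * elem_tensor m (X k) is js) | (N::nat) c X.
       \<forall>k<N. \<forall>l<m. X k l \<in> D}"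

definition Dinf :: "(complex \<Rightarrow> 'b::real_normed_vector) \<Rightarrow> ('b \<Rightarrow> nat \<Rightarrow> nat \<Rightarrow> 'b) \<Rightarrow> (nat \<Rightarrow> nat \<Rightarrow> complex) set \<Rightarrow> 'b set" where
  "Dinf cs \<psi> D = closure (\<Union>m\<in>{1..}. kappa cs \<psi> m ` tensor_pow m D)"

definition pos_contraction :: "(complex \<Rightarrow> 'b::real_normed_algebra_1) \<Rightarrow> ('b \<Rightarrow> 'b) \<Rightarrow> ('b \<Rightarrow> complex) \<Rightarrow> bool" where
  "pos_contraction cs st \<phi> \<longleftrightarrow>
     (\<forall>x y. \<phi> (x + y) = \<phi> x + \<phi> y) \<and> (\<forall>c x. \<phi> (cs c * x) = c * \<phi> x) \<and>
     (\<forall>x. Im (\<phi> (st x * x)) = 0 \<and> Re (\<phi> (st x * x)) \<ge> 0) \<and>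
     (\<forall>x. cmod (\<phi> x) \<le> norm x)"

end

theory Submission
  imports Defs
begin

text \<open>
  Since \<open>\<sigma>\<^sub>1(A) \<subseteq> A\<close> and \<open>A\<close> equals its own commutant, the matrix entries of \<open>\<psi>(a)\<close> lie in \<open>A\<close>;
  since \<open>\<sigma>\<^sub>2(A) \<subseteq> A\<close>, so do the slices \<open>\<psi>\<inverse>((\<psi>(a\<^sub>i\<^sub>j)\<^sub>k\<^sub>l)\<^sub>i\<^sub>j)\<close>.  Iterating, every one-leg slice of
  \<open>\<phi>\<^sub>m(a)\<close> lies in \<open>D\<close>, which in finite dimensions means \<open>\<phi>\<^sub>m(a) \<in> D\<^sup>\<otimes>\<^sup>m\<close>.  The maps \<open>\<kappa>\<^sub>m \<circ> \<phi>\<^sub>m\<close>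
  are contractions fixing \<open>\<kappa>\<^sub>m(M\<^sub>n\<^sup>\<otimes>\<^sup>m)\<close>, so \<open>\<kappa>\<^sub>m(\<phi>\<^sub>m(b))\<close> gets arbitrarily close to each \<open>b \<in> C\<close>, and hence
  \<open>A \<inter> C \<subseteq> D\<^sup>\<infinity>\<close>.  For every abelian *-subalgebra \<open>S \<supseteq> D\<close> of \<open>M\<^sub>n\<close> the algebra \<open>S\<^sup>\<infinity>\<close> is abelian, lies
  in \<open>C\<close> and contains \<open>A \<inter> C\<close>, so maximality of \<open>A \<inter> C\<close> forces \<open>S\<^sup>\<infinity> = A \<inter> C\<close>.  Taking \<open>S = D\<close>
  gives the first claim; in general it gives \<open>\<kappa>\<^sub>1(S) \<subseteq> A\<close> and so \<open>S = \<phi>\<^sub>1(\<kappa>\<^sub>1(S)) \<subseteq> D\<close>.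
\<close>

section \<open>C*-algebras\<close>

text \<open>The root is the binomial series of \<open>(1 - h)\<close> to the power
  \<open>1/2\<close>, absolutely convergent because \<open>norm h < 1\<close>. Its terms are real
  multiples of powers of \<open>h\<close>, so continuity of \<open>st\<close> makes the sum
  self-adjoint.\<close>

lemma sqrt_one_minus_selfadjoint:
  fixes h :: "'b::{real_normed_algebra_1,banach}"
  assumes h: "norm h < 1" and st: "bounded_linear st" "\<And>x y. st (x * y) = st y * st x"
    and h_st: "st h = h" and one: "st 1 = 1"
  shows "\<exists>y. st y = y \<and> y * y = 1 - h"
proof -
  define f :: "nat \<Rightarrow> 'b" where "f k = (((1/2::real) gchoose k) * (-1) ^ k) *\<^sub>R h ^ k" for k
  \<comment> \<open>Excluding natural exponents pins the radius of convergence of the binomial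
    series to exactly 1.\<close>
  have half: "(1/2::real) \<notin> \<nat>"
  proof
    assume "(1/2::real) \<in> \<nat>"
    then obtain k where "(1/2::real) = of_nat k" by (rule Nats_cases)
    then have "real 1 = real (2 * k)" by simp
    then show False by (subst (asm) of_nat_eq_iff) presburger
  qed
  have "ereal (norm (norm h)) < conv_radius (\<lambda>k. (1/2::real) gchoose k)"
    using h half by (simp add: conv_radius_gchoose)
  then have "summable (\<lambda>k. norm (((1/2::real) gchoose k) * norm h ^ k))"
    by (rule abs_summable_in_conv_radius)
  then have sf: "summable (\<lambda>k. norm (f k))"
  proof (rule summable_comparison_test')
    fix k
    have "norm (f k) \<le> \<bar>(1/2::real) gchoose k\<bar> * norm h ^ k"
      by (auto simp: f_def abs_mult power_abs intro: mult_left_mono norm_power_ineq)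
    then show "norm (norm (f k)) \<le> norm (((1/2::real) gchoose k) * norm h ^ k)"
      by (simp add: abs_mult)
  qed
  \<comment> \<open>By Vandermonde's identity, squaring the series with exponent \<open>1/2\<close>
    gives the one with exponent 1, whose coefficients vanish beyond \<open>k = 1\<close>.\<close>
  have conv: "(\<Sum>i\<le>k. f i * f (k - i)) = ((1 gchoose k) * (-1) ^ k) *\<^sub>R h ^ k" for k
  proof -
    have "f i * f (k - i) = (((1/2::real) gchoose i) * ((1/2) gchoose (k - i))) *\<^sub>R ((-1) ^ k *\<^sub>R h ^ k)" if "i \<le> k" for i
      using that by (simp add: f_def power_add[symmetric] mult_ac)
    then have "(\<Sum>i\<le>k. f i * f (k - i)) = (\<Sum>i\<le>k. ((1/2::real) gchoose i) * ((1/2) gchoose (k - i))) *\<^sub>R ((-1) ^ k *\<^sub>R h ^ k)"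
      by (simp add: scaleR_sum_left[symmetric] sum_distrib_right[symmetric])
    then show ?thesis
      using gbinomial_Vandermonde[of "1/2::real" "1/2" k] by (simp add: atMost_atLeast0)
  qed
  have "(\<lambda>k. \<Sum>i\<le>k. f i * f (k - i)) sums ((\<Sum>k. f k) * (\<Sum>k. f k))"
    using Cauchy_product_sums[OF sf sf] .
  moreover have "(\<lambda>k. \<Sum>i\<le>k. f i * f (k - i)) sums (\<Sum>k\<in>{0,1}. \<Sum>i\<le>k. f i * f (k - i))"
  proof (rule sums_finite)
    fix k :: nat assume "k \<notin> {0,1}"
    then have "1 < k" by auto
    then have "(1::real) gchoose k = 0"
      by (metis binomial_eq_0 binomial_gbinomial of_nat_0 of_nat_1)
    then show "(\<Sum>i\<le>k. f i * f (k - i)) = 0"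
      by (simp add: conv)
  qed simp
  moreover have "(\<Sum>k\<in>{0,1}. \<Sum>i\<le>k. f i * f (k - i)) = 1 - h"
    by (simp add: conv del: atMost_0 sum.atMost_Suc)
  ultimately have sq: "(\<Sum>k. f k) * (\<Sum>k. f k) = 1 - h"
    by (metis sums_unique2)
  have pw: "st (h ^ k) = h ^ k" for k
    by (induction k) (simp_all add: one st(2) h_st power_commutes)
  have "st (f k) = f k" for k
    by (simp add: f_def linear_cmul[OF bounded_linear.linear[OF st(1)]] pw)
  then have "st (\<Sum>k. f k) = (\<Sum>k. f k)"
    using bounded_linear.suminf[OF st(1) summable_norm_cancel[OF sf]] by simp
  with sq show ?thesis by blast
qed

text \<open>If \<open>b > 0\<close> and \<open>a > b\<close>, the powers of \<open>a / b\<close>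
  outgrow any constant. This removes the multiplicative constant in
  \<open>norm_kappa_le\<close>.\<close>

lemma le_if_power_le:
  fixes a b K :: real
  assumes "0 \<le> a" "0 \<le> b" and le: "\<And>k. a ^ (2 ^ k) \<le> K * b ^ (2 ^ k)"
  shows "a \<le> b"
proof (rule ccontr)
  assume "\<not> a \<le> b"
  show False
  proof (cases "b = 0")
    case True
    with le[of 0] \<open>\<not> a \<le> b\<close> show ?thesis by simp
  next
    case False
    with assms \<open>\<not> a \<le> b\<close> have b: "0 < b" and ab: "1 < a / b" by auto
    obtain k where k: "K < (a / b) ^ k"
      using real_arch_pow[OF ab] by blast
    have "(a / b) ^ k \<le> (a / b) ^ (2 ^ k)"
      using ab by (intro power_increasing) (auto simp: less_imp_le)
    also have "\<dots> \<le> K"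
      using le[of k] b by (simp add: power_divide field_simps)
    finally show False using k by simp
  qed
qed

locale cstar =
  fixes cs :: "complex \<Rightarrow> 'b::{real_normed_algebra_1,banach}" and st :: "'b \<Rightarrow> 'b"
  assumes cstar: "cstar_alg cs st"
begin

lemma cs_1 [simp]: "cs 1 = 1"
  and cs_add: "cs (a + b) = cs a + cs b"
  and cs_mult: "cs (a * b) = cs a * cs b"
  and cs_of_real: "cs (complex_of_real r) = of_real r"
  and cs_comm: "cs c * x = x * cs c"
  and norm_cs_mult: "norm (cs c * x) = cmod c * norm x"
  and st_st [simp]: "st (st x) = x"
  and st_add: "st (x + y) = st x + st y"
  and st_mult: "st (x * y) = st y * st x"
  and st_cs_mult: "st (cs c * x) = cs (cnj c) * st x"
  and norm_st_mult: "norm (st x * x) = (norm x)\<^sup>2"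
  using cstar unfolding cstar_alg_def by blast+

lemma cs_0 [simp]: "cs 0 = 0"
  using cs_add[of 0 0] by simp

lemma cs_minus: "cs (- a) = - cs a"
  using cs_add[of a "- a"] by (simp add: eq_neg_iff_add_eq_0 add.commute)

lemma cs_sum: "cs (\<Sum>i\<in>I. f i) = (\<Sum>i\<in>I. cs (f i))"
  by (induction I rule: infinite_finite_induct) (simp_all add: cs_add)

lemma cs_left_commute: "x * (cs c * y) = cs c * (x * y)"
  by (metis cs_comm mult.assoc)

lemma cs_mult_cs_mult: "(cs a * x) * (cs b * y) = cs (a * b) * (x * y)"
  by (simp only: cs_mult mult.assoc cs_left_commute[of x])

lemma st_1 [simp]: "st 1 = 1"
  by (metis mult_1_right mult_1_left st_mult st_st)

lemma st_0 [simp]: "st 0 = 0"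
  using st_add[of 0 0] by simp

lemma st_minus: "st (- x) = - st x"
  using st_add[of x "- x"] by (simp add: eq_neg_iff_add_eq_0 add.commute)

lemma st_diff: "st (x - y) = st x - st y"
  using st_add[of x "- y"] by (simp add: st_minus)

lemma st_cs [simp]: "st (cs c) = cs (cnj c)"
  using st_cs_mult[of c 1] by simp

lemma norm_st [simp]: "norm (st x) = norm x"
proof -
  have le: "norm y \<le> norm (st y)" for y
  proof (cases "y = 0")
    case False
    have "norm y * norm y \<le> norm (st y) * norm y"
      using norm_st_mult[of y] norm_mult_ineq[of "st y" y] by (simp add: power2_eq_square)
    with False show ?thesis by simp
  qed simp
  show ?thesis using le[of x] le[of "st x"] by simp
qed

lemma scaleR_cs: "r *\<^sub>R x = cs (complex_of_real r) * x"
  by (simp add: cs_of_real scaleR_conv_of_real)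

lemma bounded_linear_st: "bounded_linear st"
  by (rule bounded_linear_intro[where K = 1]) (simp_all add: st_add scaleR_cs st_cs_mult)

text \<open>For \<open>\<parallel>x\<parallel>\<^sup>2 < t\<close> the element \<open>1 - x\<^sup>*x / t\<close> is a square \<open>y\<^sup>*y\<close>, so that no continuity of \<open>\<omega>\<close>
  is needed.\<close>

lemma positive_functional_le:
  assumes add: "\<And>x y. \<omega> (x + y) = \<omega> x + \<omega> y" and hom: "\<And>c x. \<omega> (cs c * x) = c * \<omega> x"
    and pos: "\<And>x. 0 \<le> Re (\<omega> (st x * x))"
  shows "Re (\<omega> (st x * x)) \<le> (norm x)\<^sup>2 * Re (\<omega> 1)"
proof -
  have one: "0 \<le> Re (\<omega> 1)" using pos[of 1] by simp
  have "Re (\<omega> (st x * x)) \<le> t * Re (\<omega> 1)" if t: "(norm x)\<^sup>2 < t" for t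
  proof -
    have t0: "0 < t" using t by (metis le_less_trans zero_le_power2)
    define h where "h = cs (complex_of_real (1 / t)) * (st x * x)"
    have "norm h < 1"
      using t t0 by (simp add: h_def norm_cs_mult norm_st_mult norm_divide)
    moreover have "st h = h"
      by (simp add: h_def st_cs_mult st_mult cs_comm)
    ultimately obtain y where y: "st y = y" "y * y = 1 - h"
      using sqrt_one_minus_selfadjoint[OF _ bounded_linear_st st_mult] by auto
    have "\<omega> (1 - h) = \<omega> 1 - \<omega> h"
      using add[of "1 - h" h] by simp
    then have "0 \<le> Re (\<omega> 1 - \<omega> h)"
      using pos[of y] y by simp
    then have "Re (\<omega> (st x * x)) / t \<le> Re (\<omega> 1)"
      by (simp only: h_def hom) simp
    then show ?thesis using t0 by (simp add: field_simps)
  qed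
  note le = this
  show ?thesis
  proof (rule field_le_epsilon)
    fix e :: real assume "0 < e"
    \<comment> \<open>The added 1 keeps the denominator positive when \<open>Re (\<omega> 1)\<close>
      is zero.\<close>
    define d where "d = e / (Re (\<omega> 1) + 1)"
    have d: "0 < d" "d * Re (\<omega> 1) \<le> e"
      using \<open>0 < e\<close> one by (simp_all add: d_def field_simps)
    then show "Re (\<omega> (st x * x)) \<le> (norm x)\<^sup>2 * Re (\<omega> 1) + e"
      using le[of "(norm x)\<^sup>2 + d"] by (simp add: algebra_simps)
  qed
qed

text \<open>For self-adjoint \<open>x\<close>, the bicommutant of \<open>A \<union> {x}\<close> is an abelian *-subalgebra.\<close>

lemma commutant_masa:
  assumes A: "masa_in cs st UNIV A" and x: "\<And>a. a \<in> A \<Longrightarrow> a * x = x * a"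
  shows "x \<in> A"
proof -
  have sub: "star_subalg cs st A" and ab: "abelian_set A"
    and max: "\<And>S. A \<subseteq> S \<Longrightarrow> star_subalg cs st S \<Longrightarrow> abelian_set S \<Longrightarrow> S = A"
    using A unfolding masa_in_def by blast+
  have selfadjoint: "y \<in> A" if "st y = y" and y: "\<And>a. a \<in> A \<Longrightarrow> a * y = y * a" for y
  proof -
    \<comment> \<open>\<open>G\<close> is the commutant of \<open>insert y A\<close> and
      \<open>S\<close> its bicommutant. Since \<open>insert y A\<close> is commutative, it lies in
      \<open>G\<close>, whence \<open>S \<subseteq> G\<close> and \<open>S\<close> is
      abelian.\<close>
    define G where "G = {g. \<forall>a\<in>insert y A. g * a = a * g}"
    define S where "S = {s. \<forall>g\<in>G. s * g = g * s}"
    have G_st: "st g \<in> G" if "g \<in> G" for g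
      unfolding G_def
    proof (intro CollectI ballI)
      fix a assume a: "a \<in> insert y A"
      have "st a \<in> insert y A"
        using a sub \<open>st y = y\<close> by (auto simp: star_subalg_def)
      with \<open>g \<in> G\<close> have "st (g * st a) = st (st a * g)" by (auto simp: G_def)
      then show "st g * a = a * st g" by (simp add: st_mult)
    qed
    have AG: "insert y A \<subseteq> G"
      using ab y by (auto simp: G_def abelian_set_def)
    have AS: "insert y A \<subseteq> S"
      by (auto simp: S_def G_def)
    have SG: "S \<subseteq> G"
      using AG by (auto simp: S_def G_def)
    have "star_subalg cs st S"
      unfolding star_subalg_def
    proof (intro conjI ballI allI)
      show "0 \<in> S" by (simp add: S_def)
      fix s assume s: "s \<in> S"
      show "st s \<in> S"
        unfolding S_def
      proof (intro CollectI ballI)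
        fix g assume "g \<in> G"
        with s have "st (s * st g) = st (st g * s)" using G_st by (simp add: S_def)
        then show "st s * g = g * st s" by (simp add: st_mult)
      qed
      show "cs c * s \<in> S" for c
        using s by (auto simp: S_def mult.assoc cs_left_commute)
      fix t assume t: "t \<in> S"
      show "s + t \<in> S"
        using s t by (simp add: S_def distrib_left distrib_right)
      show "s * t \<in> S"
        using s t by (simp add: S_def) (metis mult.assoc)
    qed
    moreover have "abelian_set S"
      using SG by (auto simp: S_def abelian_set_def)
    ultimately have "S = A" using max AS by blast
    with AS show ?thesis by blast
  qed
  have xs: "a * st x = st x * a" if "a \<in> A" for a
  proof -
    have "st (st a * x) = st (x * st a)"
      using that sub x by (simp add: star_subalg_def)
    then show ?thesis by (simp add: st_mult)
  qed
  \<comment> \<open>A general \<open>x\<close> is recovered from the self-adjoint elements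
    \<open>x + st x\<close> and \<open>cs \<i> * (st x - x)\<close>. A second factor
    \<open>cs \<i>\<close> turns the latter into \<open>x - st x\<close>, and half the sum is
    \<open>x\<close>.\<close>
  have "x + st x \<in> A"
    by (rule selfadjoint) (simp_all add: st_add add.commute distrib_left distrib_right x xs)
  moreover have "cs \<i> * (st x + (- x)) \<in> A"
    by (rule selfadjoint)
      (simp_all add: st_cs_mult st_diff cs_minus left_diff_distrib right_diff_distrib x xs cs_left_commute mult.assoc)
  then have "cs \<i> * (cs \<i> * (st x + (- x))) \<in> A"
    using sub by (simp add: star_subalg_def)
  then have "x + (- st x) \<in> A"
    by (simp add: cs_mult[symmetric] mult.assoc[symmetric] cs_minus)
  ultimately have "(x + st x) + (x + (- st x)) \<in> A"
    using sub unfolding star_subalg_def by blast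
  then have "cs (1/2) * (x + x) \<in> A"
    using sub by (simp add: star_subalg_def)
  moreover have "cs (1/2) * (x + x) = cs (1/2 + 1/2) * x"
    by (simp only: cs_add distrib_left distrib_right)
  ultimately show ?thesis by simp
qed

lemma star_subalg_closure:
  assumes "star_subalg cs st S"
  shows "star_subalg cs st (closure S)"
  unfolding star_subalg_def
proof (intro conjI ballI allI)
  have S: "0 \<in> S" "\<And>x y. x \<in> S \<Longrightarrow> y \<in> S \<Longrightarrow> x + y \<in> S" "\<And>x y. x \<in> S \<Longrightarrow> y \<in> S \<Longrightarrow> x * y \<in> S"
    "\<And>c x. x \<in> S \<Longrightarrow> cs c * x \<in> S" "\<And>x. x \<in> S \<Longrightarrow> st x \<in> S"
    using assms unfolding star_subalg_def by blast+
  show "0 \<in> closure S" using S(1) closure_subset by blast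
  fix x assume "x \<in> closure S"
  then obtain f where f: "\<And>k. f k \<in> S" "f \<longlonglongrightarrow> x" unfolding closure_sequential by blast
  show "cs c * x \<in> closure S" for c
    unfolding closure_sequential
    using f S(4) by (intro exI[of _ "\<lambda>k. cs c * f k"]) (auto intro: tendsto_mult_left)
  show "st x \<in> closure S"
    unfolding closure_sequential
    using f S(5) by (intro exI[of _ "\<lambda>k. st (f k)"]) (auto intro: bounded_linear.tendsto[OF bounded_linear_st])
  fix y assume "y \<in> closure S"
  then obtain g where g: "\<And>k. g k \<in> S" "g \<longlonglongrightarrow> y" unfolding closure_sequential by blast
  show "x + y \<in> closure S"
    unfolding closure_sequential
    using f g S(2) by (intro exI[of _ "\<lambda>k. f k + g k"]) (auto intro: tendsto_add)
  show "x * y \<in> closure S"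
    unfolding closure_sequential
    using f g S(3) by (intro exI[of _ "\<lambda>k. f k * g k"]) (auto intro: tendsto_mult)
qed

end

lemma abelian_set_closure:
  fixes S :: "'b::real_normed_algebra set"
  assumes S: "abelian_set S"
  shows "abelian_set (closure S)"
  unfolding abelian_set_def
proof (intro ballI)
  fix x y assume "x \<in> closure S" "y \<in> closure S"
  then obtain f g where f: "\<And>k. f k \<in> S" "f \<longlonglongrightarrow> x" and g: "\<And>k. g k \<in> S" "g \<longlonglongrightarrow> y"
    unfolding closure_sequential by blast
  have "(\<lambda>k. f k * g k) \<longlonglongrightarrow> x * y" "(\<lambda>k. g k * f k) \<longlonglongrightarrow> y * x"
    using f g by (auto intro: tendsto_mult)
  moreover have "(\<lambda>k. f k * g k) = (\<lambda>k. g k * f k)"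
    using f g S by (auto simp: abelian_set_def)
  ultimately show "x * y = y * x" by (metis LIMSEQ_unique)
qed

section \<open>Matrices and tensor powers of matrix algebras\<close>

text \<open>Reduced echelon form: coordinates with respect to the basis \<open>d\<close> are values at the pivots \<open>P\<close>.\<close>

lemma subspace_pivots:
  fixes S :: "('a \<Rightarrow> 'k::field) set"
  assumes I: "finite I" and supp: "\<And>Z i. Z \<in> S \<Longrightarrow> i \<notin> I \<Longrightarrow> Z i = 0"
    and zero: "(\<lambda>i. 0) \<in> S"
    and add: "\<And>X Y. X \<in> S \<Longrightarrow> Y \<in> S \<Longrightarrow> (\<lambda>i. X i + Y i) \<in> S"
    and scale: "\<And>c X. X \<in> S \<Longrightarrow> (\<lambda>i. c * X i) \<in> S"
  shows "\<exists>P d. finite P \<and> (\<forall>p\<in>P. d p \<in> S) \<and> (\<forall>Z\<in>S. \<forall>i. Z i = (\<Sum>p\<in>P. Z p * d p i))"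
proof -
  have lincomb: "(\<lambda>i. Z i - (\<Sum>p\<in>P. c p * d p i)) \<in> S"
    if "Z \<in> S" "finite P" "\<forall>p\<in>P. d p \<in> S" for Z P c and d :: "'a \<Rightarrow> 'a \<Rightarrow> 'k"
    using that(2,3)
  proof (induction P rule: finite_induct)
    case (insert p P)
    then have "(\<lambda>i. (Z i - (\<Sum>p\<in>P. c p * d p i)) + (- c p) * d p i) \<in> S"
      by (intro add scale) auto
    then show ?case using insert by (simp add: algebra_simps)
  qed (simp add: that(1))
  \<comment> \<open>Gauss-Jordan elimination, one coordinate at a time: \<open>J\<close> collects
    the coordinates on which the expansion is already exact.\<close>
  have "\<exists>P d. P \<subseteq> J \<and> (\<forall>p\<in>P. d p \<in> S) \<and> (\<forall>Z\<in>S. \<forall>i\<in>J. Z i - (\<Sum>p\<in>P. Z p * d p i) = 0)"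
    if "finite J" for J
    using that
  proof (induction J rule: finite_induct)
    case (insert j J)
    then obtain P d where P: "P \<subseteq> J" "\<forall>p\<in>P. d p \<in> S"
      and van: "\<And>Z i. Z \<in> S \<Longrightarrow> i \<in> J \<Longrightarrow> Z i - (\<Sum>p\<in>P. Z p * d p i) = 0"
      by blast
    have fP: "finite P" using P insert finite_subset by blast
    define R where "R Z i = Z i - (\<Sum>p\<in>P. Z p * d p i)" for Z i
    have R_S: "R Z \<in> S" if "Z \<in> S" for Z
      using lincomb[OF that fP P(2)] by (simp add: R_def[abs_def])
    show ?case
    proof (cases "\<forall>Z\<in>S. R Z j = 0")
      case True
      have "Z i - (\<Sum>p\<in>P. Z p * d p i) = 0" if "Z \<in> S" "i \<in> insert j J" for Z i
        using that van True unfolding R_def by blast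
      then show ?thesis using P by (intro exI[of _ P] exI[of _ d] conjI ballI) auto
    next
      case False
      then obtain Z0 where Z0: "Z0 \<in> S" "R Z0 j \<noteq> 0" by blast
      \<comment> \<open>A residual that is nonzero at \<open>j\<close> is scaled to 1 there. It
        vanishes on \<open>J\<close>, so it becomes the basis vector of the new pivot
        \<open>j\<close>, and \<open>e\<close> clears the entry at \<open>j\<close> from the old
        basis vectors.\<close>
      define w where "w i = inverse (R Z0 j) * R Z0 i" for i
      have w: "w \<in> S" "w j = 1" "\<And>i. i \<in> J \<Longrightarrow> w i = 0"
        using Z0 scale[OF R_S] van[OF Z0(1)] by (auto simp: w_def[abs_def] R_def)
      define e where "e p = (if p = j then w else (\<lambda>i. d p i - d p j * w i))" for p
      have jP: "j \<notin> P" using P insert by blast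
      have "e p \<in> S" if "p \<in> insert j P" for p
        using that P(2) w(1) add[of "d p" "\<lambda>i. (- d p j) * w i"] scale[of w "- d p j"]
        by (auto simp: e_def)
      moreover have "Z i - (\<Sum>p\<in>insert j P. Z p * e p i) = 0" if "Z \<in> S" "i \<in> insert j J" for Z i
      proof -
        have "(\<Sum>p\<in>P. Z p * e p i) = (\<Sum>p\<in>P. Z p * (d p i - d p j * w i))"
          using jP by (intro sum.cong) (auto simp: e_def)
        then have "Z i - (\<Sum>p\<in>insert j P. Z p * e p i) = R Z i - R Z j * w i"
          using jP fP by (simp add: e_def R_def algebra_simps sum_subtractf sum_distrib_left sum_distrib_right)
        also have "\<dots> = 0"
          using that w van[OF that(1)] by (auto simp: R_def)
        finally show ?thesis .
      qed
      ultimately show ?thesis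
        using P(1) by (intro exI[of _ "insert j P"] exI[of _ e] conjI ballI) auto
    qed
  qed auto
  from this[OF I] obtain P d where P: "P \<subseteq> I" "\<forall>p\<in>P. d p \<in> S"
    and van: "\<And>Z i. Z \<in> S \<Longrightarrow> i \<in> I \<Longrightarrow> Z i - (\<Sum>p\<in>P. Z p * d p i) = 0"
    by blast
  have "Z i = (\<Sum>p\<in>P. Z p * d p i)" if "Z \<in> S" for Z i
  proof (cases "i \<in> I")
    case True
    with van[OF that] show ?thesis by simp
  next
    case False
    then have "Z i = 0" "\<And>p. p \<in> P \<Longrightarrow> d p i = 0" using P(2) that supp by blast+
    then show ?thesis by simp
  qed
  moreover have "finite P" using P(1) I by (rule finite_subset)
  ultimately show ?thesis using P(2) by (intro exI[of _ P] exI[of _ d] conjI ballI allI) auto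
qed

section \<open>Bounds on the operator norm of complex matrices\<close>

text \<open>\<open>M\<close> dominates the operator norm of \<open>X\<close> on the Hilbert space
  with orthonormal basis \<open>I\<close>. The inequality form avoids a supremum.\<close>

definition op_bound :: "'i set \<Rightarrow> ('i \<Rightarrow> 'i \<Rightarrow> complex) \<Rightarrow> real \<Rightarrow> bool" where
  "op_bound I X M \<longleftrightarrow> 0 \<le> M \<and>
     (\<forall>\<xi>. (\<Sum>i\<in>I. (cmod (\<Sum>j\<in>I. X i j * \<xi> j))\<^sup>2) \<le> M\<^sup>2 * (\<Sum>i\<in>I. (cmod (\<xi> i))\<^sup>2))"

lemma op_bound_mult:
  assumes "op_bound I X M" "op_bound I Y K"
  shows "op_bound I (\<lambda>i j. \<Sum>k\<in>I. X i k * Y k j) (M * K)"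
  unfolding op_bound_def
proof (intro conjI allI)
  show "0 \<le> M * K" using assms by (simp add: op_bound_def)
  fix \<xi> :: "'a \<Rightarrow> complex"
  have "(\<Sum>j\<in>I. (\<Sum>k\<in>I. X i k * Y k j) * \<xi> j) = (\<Sum>k\<in>I. X i k * (\<Sum>j\<in>I. Y k j * \<xi> j))" for i
    unfolding sum_distrib_right sum_distrib_left by (subst sum.swap) (simp add: mult.assoc)
  then have "(\<Sum>i\<in>I. (cmod (\<Sum>j\<in>I. (\<Sum>k\<in>I. X i k * Y k j) * \<xi> j))\<^sup>2)
      \<le> M\<^sup>2 * (\<Sum>k\<in>I. (cmod (\<Sum>j\<in>I. Y k j * \<xi> j))\<^sup>2)"
    using assms(1) by (simp add: op_bound_def)
  also have "\<dots> \<le> M\<^sup>2 * (K\<^sup>2 * (\<Sum>i\<in>I. (cmod (\<xi> i))\<^sup>2))"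
    using assms(2) by (intro mult_left_mono) (auto simp: op_bound_def)
  finally show "(\<Sum>i\<in>I. (cmod (\<Sum>j\<in>I. (\<Sum>k\<in>I. X i k * Y k j) * \<xi> j))\<^sup>2)
      \<le> (M * K)\<^sup>2 * (\<Sum>i\<in>I. (cmod (\<xi> i))\<^sup>2)"
    by (simp add: power_mult_distrib mult.assoc)
qed

lemma op_bound_entry:
  assumes "op_bound I X M" "finite I" "i \<in> I" "j \<in> I"
  shows "cmod (X i j) \<le> M"
proof -
  \<comment> \<open>On the basis vector at \<open>j\<close> the matrix returns its column
    \<open>j\<close>, and the entry at \<open>i\<close> is one term of that column's squared
    norm.\<close>
  define \<xi> where "\<xi> k = (if k = j then 1 else 0 :: complex)" for k
  have "(\<Sum>k\<in>I. X r k * \<xi> k) = X r j" for r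
    using assms by (simp add: \<xi>_def if_distrib[of "\<lambda>x. _ * x"] cong: if_cong)
  moreover have "(\<Sum>k\<in>I. (cmod (\<xi> k))\<^sup>2) = (\<Sum>k\<in>I. if k = j then 1 else 0)"
    by (intro sum.cong) (auto simp: \<xi>_def)
  moreover have "(\<Sum>r\<in>I. (cmod (\<Sum>k\<in>I. X r k * \<xi> k))\<^sup>2) \<le> M\<^sup>2 * (\<Sum>k\<in>I. (cmod (\<xi> k))\<^sup>2)"
    using assms(1) by (simp add: op_bound_def)
  ultimately have "(\<Sum>r\<in>I. (cmod (X r j))\<^sup>2) \<le> M\<^sup>2"
    using assms(2,4) by simp
  moreover have "(cmod (X i j))\<^sup>2 \<le> (\<Sum>r\<in>I. (cmod (X r j))\<^sup>2)"
    using assms by (intro member_le_sum) auto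
  ultimately have "(cmod (X i j))\<^sup>2 \<le> M\<^sup>2" by simp
  then show ?thesis
    using assms(1) power2_le_imp_le by (auto simp: op_bound_def)
qed

section \<open>Multi-indices and elementary tensors\<close>

lemma finite_idx [simp]: "finite (idx n m)"
  using finite_lists_length_eq[of "{..<n}" m] by (rule rev_finite_subset) (auto simp: idx_def)

lemma idx_0: "idx n 0 = {[]}"
  by (auto simp: idx_def)

lemma Nil_in_idx [simp]: "[] \<in> idx n m \<longleftrightarrow> m = 0"
  by (auto simp: idx_def)

lemma Cons_in_idx_Suc [simp]: "i # is \<in> idx n (Suc m) \<longleftrightarrow> i < n \<and> is \<in> idx n m"
  by (auto simp: idx_def)

lemma sum_idx_Suc:
  "(\<Sum>is\<in>idx n (Suc m). f is) = (\<Sum>i<n. \<Sum>is\<in>idx n m. f (i # is))"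
proof -
  have "bij_betw (\<lambda>(i, is). i # is) ({..<n} \<times> idx n m) (idx n (Suc m))"
    by (rule bij_betwI[where g = "\<lambda>is. (hd is, tl is)"])
      (auto simp: idx_def length_Suc_conv)
  from sum.reindex_bij_betw[OF this, of f] show ?thesis
    by (simp add: sum.cartesian_product case_prod_unfold)
qed

definition tmult :: "nat \<Rightarrow> nat \<Rightarrow> (nat list \<Rightarrow> nat list \<Rightarrow> 'a::semiring_0) \<Rightarrow> (nat list \<Rightarrow> nat list \<Rightarrow> 'a) \<Rightarrow> nat list \<Rightarrow> nat list \<Rightarrow> 'a" where
  "tmult n m X Y = (\<lambda>is js. \<Sum>ks\<in>idx n m. X is ks * Y ks js)"

lemma tmat_carD: "X \<in> tmat_car n m \<Longrightarrow> is \<notin> idx n m \<or> js \<notin> idx n m \<Longrightarrow> X is js = 0"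
  by (auto simp: tmat_car_def)

lemma tmult_in_tmat_car:
  assumes "X \<in> tmat_car n m" "Y \<in> tmat_car n m"
  shows "tmult n m X Y \<in> tmat_car n m"
proof -
  have "tmult n m X Y is js = 0" if "is \<notin> idx n m \<or> js \<notin> idx n m" for "is" js
    using that assms by (auto simp: tmult_def tmat_carD[of _ n m])
  then show ?thesis unfolding tmat_car_def by blast
qed

lemma elem_tensor_0: "elem_tensor 0 X is js = (if is = [] \<and> js = [] then 1 else 0)"
  by (simp add: elem_tensor_def)

lemma elem_tensor_Nil [simp]:
  "elem_tensor (Suc m) X [] js = 0" "elem_tensor (Suc m) X is [] = 0"
  by (simp_all add: elem_tensor_def)

lemma elem_tensor_Cons [simp]:
  "elem_tensor (Suc m) X (i # is) (j # js) = X 0 i j * elem_tensor m (\<lambda>l. X (Suc l)) is js"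
  by (simp add: elem_tensor_def prod.lessThan_Suc_shift del: prod.lessThan_Suc)

lemma elem_tensor_cong:
  "(\<And>l. l < m \<Longrightarrow> X l = Y l) \<Longrightarrow> elem_tensor m X = elem_tensor m Y"
  by (simp add: elem_tensor_def fun_eq_iff)

text \<open>The sum over multi-indices factors leg by leg, so elementary tensors multiply
  componentwise.\<close>

lemma elem_tensor_mult:
  "tmult n m (elem_tensor m X) (elem_tensor m Y) is js = elem_tensor m (\<lambda>l. mmult n (X l) (Y l)) is js"
proof (induction m arbitrary: X Y "is" js)
  case 0
  then show ?case by (simp add: tmult_def idx_0 elem_tensor_0)
next
  case (Suc m)
  show ?case
  proof (cases "is = [] \<or> js = []")
    case True
    then show ?thesis by (auto simp: tmult_def)
  next
    case False
    then obtain i is' j js' where [simp]: "is = i # is'" "js = j # js'"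
      by (auto simp: neq_Nil_conv)
    have "tmult n (Suc m) (elem_tensor (Suc m) X) (elem_tensor (Suc m) Y) is js =
      (\<Sum>k<n. \<Sum>ks\<in>idx n m. (X 0 i k * Y 0 k j) *
        (elem_tensor m (\<lambda>l. X (Suc l)) is' ks * elem_tensor m (\<lambda>l. Y (Suc l)) ks js'))"
      unfolding tmult_def sum_idx_Suc by (simp add: mult_ac)
    also have "\<dots> = mmult n (X 0) (Y 0) i j *
        tmult n m (elem_tensor m (\<lambda>l. X (Suc l))) (elem_tensor m (\<lambda>l. Y (Suc l))) is' js'"
      by (simp add: mmult_def tmult_def sum_product)
    finally show ?thesis by (simp add: Suc)
  qed
qed

lemma elem_tensor_star:
  "elem_tensor m (\<lambda>l i j. cnj (X l j i)) is js = cnj (elem_tensor m X js is)"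
  by (simp add: elem_tensor_def)

lemma elem_tensor_in_tmat_car:
  assumes "\<And>l. l < m \<Longrightarrow> X l \<in> mat_car n"
  shows "elem_tensor m X \<in> tmat_car n m"
proof -
  have "is \<in> idx n m \<and> js \<in> idx n m" if "elem_tensor m X is js \<noteq> 0" for "is" js
  proof -
    have len: "length is = m" "length js = m" and nz: "\<And>l. l < m \<Longrightarrow> X l (is ! l) (js ! l) \<noteq> 0"
      using that by (auto simp: elem_tensor_def split: if_splits)
    have "is ! l < n" "js ! l < n" if "l < m" for l
      using nz[OF that] assms[OF that] unfolding mat_car_def mem_Collect_eq by (metis not_less)+
    with len show ?thesis by (auto simp: idx_def in_set_conv_nth)
  qed
  then show ?thesis by (simp add: tmat_car_def)
qed

section \<open>Algebra in the tensor power of a set of matrices\<close>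

lemma zero_in_tensor_pow: "(\<lambda>is js. 0) \<in> tensor_pow m S"
  unfolding tensor_pow_def by (rule CollectI, rule exI[of _ 0]) simp

lemma elem_tensor_add_in_tensor_pow:
  assumes X: "X \<in> tensor_pow m S" and Y: "\<And>l. l < m \<Longrightarrow> Y l \<in> S"
  shows "(\<lambda>is js. c * elem_tensor m Y is js + X is js) \<in> tensor_pow m S"
proof -
  obtain N :: nat and d Z where N: "X = (\<lambda>is js. \<Sum>k<N. d k * elem_tensor m (Z k) is js)"
    "\<forall>k<N. \<forall>l<m. Z k l \<in> S"
    using X unfolding tensor_pow_def by auto
  show ?thesis unfolding tensor_pow_def
    by (rule CollectI, rule exI[of _ "Suc N"], rule exI[of _ "d(N := c)"], rule exI[of _ "Z(N := Y)"])
      (use N Y in \<open>auto simp: fun_eq_iff less_Suc_eq\<close>)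
qed

lemma elem_tensor_in_tensor_pow: "(\<And>l. l < m \<Longrightarrow> Y l \<in> S) \<Longrightarrow> elem_tensor m Y \<in> tensor_pow m S"
  using elem_tensor_add_in_tensor_pow[OF zero_in_tensor_pow, of m Y S 1] by simp

text \<open>Elementary tensors are added one at a time, which reduces linear statements about
  \<open>tensor_pow\<close> to elementary tensors.\<close>

lemma tensor_pow_induct [consumes 1, case_names zero add]:
  assumes "X \<in> tensor_pow m S" and zero: "P (\<lambda>is js. 0)"
    and add: "\<And>c Y X. (\<And>l. l < m \<Longrightarrow> Y l \<in> S) \<Longrightarrow> X \<in> tensor_pow m S \<Longrightarrow> P X \<Longrightarrow>
      P (\<lambda>is js. c * elem_tensor m Y is js + X is js)"
  shows "P X"
proof -
  obtain N :: nat and d Z where N: "X = (\<lambda>is js. \<Sum>k<N. d k * elem_tensor m (Z k) is js)"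
    "\<forall>k<N. \<forall>l<m. Z k l \<in> S"
    using assms(1) unfolding tensor_pow_def by auto
  have "(\<lambda>is js. \<Sum>k<K. d k * elem_tensor m (Z k) is js) \<in> tensor_pow m S \<and>
      P (\<lambda>is js. \<Sum>k<K. d k * elem_tensor m (Z k) is js)" if "K \<le> N" for K
    using that
  proof (induction K)
    case (Suc K)
    have "Z K l \<in> S" if "l < m" for l using N Suc.prems that by auto
    then show ?case
      using add[of "Z K" _ "d K"] elem_tensor_add_in_tensor_pow[of _ m S "Z K" "d K"] Suc
      by (simp add: add.commute[of "sum _ _"])
  qed (simp add: zero zero_in_tensor_pow)
  then show ?thesis using N(1) by auto
qed

lemma add_in_tensor_pow:
  assumes "X \<in> tensor_pow m S" "Y \<in> tensor_pow m S"
  shows "(\<lambda>is js. X is js + Y is js) \<in> tensor_pow m S"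
  using assms(1)
proof (induction rule: tensor_pow_induct)
  case (add c Z X)
  then show ?case
    using elem_tensor_add_in_tensor_pow[of "\<lambda>is js. X is js + Y is js" m S Z c]
    by (simp add: add.assoc)
qed (simp add: assms(2))

lemma scale_in_tensor_pow:
  assumes "X \<in> tensor_pow m S"
  shows "(\<lambda>is js. c * X is js) \<in> tensor_pow m S"
  using assms
proof (induction rule: tensor_pow_induct)
  case (add d Z X)
  then show ?case
    using elem_tensor_add_in_tensor_pow[of "\<lambda>is js. c * X is js" m S Z "c * d"]
    by (simp add: algebra_simps)
qed (simp add: zero_in_tensor_pow)

lemma sum_in_tensor_pow:
  assumes "\<And>p. p \<in> P \<Longrightarrow> X p \<in> tensor_pow m S"
  shows "(\<lambda>is js. \<Sum>p\<in>P. X p is js) \<in> tensor_pow m S"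
  using assms
  by (induction P rule: infinite_finite_induct) (auto intro: zero_in_tensor_pow add_in_tensor_pow)

lemma tensor_pow_mono: "S \<subseteq> T \<Longrightarrow> tensor_pow m S \<subseteq> tensor_pow m T"
  unfolding tensor_pow_def by blast

lemma tensor_pow_subset_tmat_car:
  assumes "S \<subseteq> mat_car n"
  shows "tensor_pow m S \<subseteq> tmat_car n m"
proof
  fix X assume "X \<in> tensor_pow m S"
  then show "X \<in> tmat_car n m"
  proof (induction rule: tensor_pow_induct)
    case (add c Y X)
    then have "elem_tensor m Y \<in> tmat_car n m"
      using assms by (intro elem_tensor_in_tmat_car) auto
    with add have "c * elem_tensor m Y is js + X is js = 0" if "is \<notin> idx n m \<or> js \<notin> idx n m" for "is" js
      using that by (simp add: tmat_carD[of _ n m])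
    then show ?case unfolding tmat_car_def by blast
  qed (simp add: tmat_car_def)
qed

lemma star_in_tensor_pow:
  assumes S: "\<And>Z. Z \<in> S \<Longrightarrow> (\<lambda>i j. cnj (Z j i)) \<in> S" and X: "X \<in> tensor_pow m S"
  shows "(\<lambda>is js. cnj (X js is)) \<in> tensor_pow m S"
  using X
proof (induction rule: tensor_pow_induct)
  case (add c Y X)
  then show ?case
    using elem_tensor_add_in_tensor_pow[of "\<lambda>is js. cnj (X js is)" m S "\<lambda>l i j. cnj (Y l j i)" "cnj c"] S
    by (simp add: elem_tensor_star)
qed (simp add: zero_in_tensor_pow)

lemma tmult_add_left: "tmult n m (\<lambda>is js. c * X is js + Y is js) Z is js = c * tmult n m X Z is js + tmult n m Y Z is js"
  for c :: complex
  by (simp add: tmult_def distrib_right sum.distrib sum_distrib_left mult.assoc)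

lemma tmult_add_right: "tmult n m Z (\<lambda>is js. c * X is js + Y is js) is js = c * tmult n m Z X is js + tmult n m Z Y is js"
  for c :: complex
  by (simp add: tmult_def distrib_left sum.distrib sum_distrib_left mult_ac)

text \<open>Bilinearity reduces each factor in turn to elementary tensors, the right one first.
  There \<open>elem_tensor_mult\<close> applies, as it does for
  \<open>tensor_pow_commute\<close>.\<close>

lemma tmult_in_tensor_pow:
  assumes S: "\<And>Z W. Z \<in> S \<Longrightarrow> W \<in> S \<Longrightarrow> mmult n Z W \<in> S"
    and X: "X \<in> tensor_pow m S" and Y: "Y \<in> tensor_pow m S"
  shows "tmult n m X Y \<in> tensor_pow m S"
proof -
  have elem: "tmult n m (elem_tensor m Z) Y \<in> tensor_pow m S" if Z: "\<And>l. l < m \<Longrightarrow> Z l \<in> S" for Z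
    using Y
  proof (induction rule: tensor_pow_induct)
    case zero
    then show ?case by (simp add: tmult_def[abs_def] zero_in_tensor_pow)
  next
    case (add c W X)
    then show ?case
      using elem_tensor_add_in_tensor_pow[of "tmult n m (elem_tensor m Z) X" m S "\<lambda>l. mmult n (Z l) (W l)" c] S Z
      by (simp add: tmult_add_right[abs_def] elem_tensor_mult)
  qed
  show ?thesis using X
  proof (induction rule: tensor_pow_induct)
    case zero
    then show ?case by (simp add: tmult_def[abs_def] zero_in_tensor_pow)
  next
    case (add c Z X)
    then show ?case
      using add_in_tensor_pow[OF scale_in_tensor_pow[OF elem, of Z c] add.IH]
      by (simp add: tmult_add_left[abs_def])
  qed
qed

lemma tensor_pow_commute:
  assumes S: "\<And>Z W. Z \<in> S \<Longrightarrow> W \<in> S \<Longrightarrow> mmult n Z W = mmult n W Z"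
    and X: "X \<in> tensor_pow m S" and Y: "Y \<in> tensor_pow m S"
  shows "tmult n m X Y = tmult n m Y X"
proof -
  have elem: "tmult n m (elem_tensor m Z) Y = tmult n m Y (elem_tensor m Z)" if Z: "\<And>l. l < m \<Longrightarrow> Z l \<in> S" for Z
    using Y
  proof (induction rule: tensor_pow_induct)
    case (add c W X)
    then have "elem_tensor m (\<lambda>l. mmult n (Z l) (W l)) = elem_tensor m (\<lambda>l. mmult n (W l) (Z l))"
      using S Z by (intro elem_tensor_cong) auto
    with add show ?case
      by (simp add: fun_eq_iff tmult_add_right tmult_add_left elem_tensor_mult)
  qed (simp add: tmult_def)
  show ?thesis using X
  proof (induction rule: tensor_pow_induct)
    case (add c Z X)
    then show ?case
      using elem[of Z] by (simp add: fun_eq_iff tmult_add_right tmult_add_left)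
  qed (simp add: tmult_def)
qed

section \<open>Adding a tensor leg, and the slice criterion\<close>

text \<open>This is \<open>d \<otimes> X\<close> with the new leg in front, which suits the
  recursion over slices. Its mirror image \<open>tsnoc\<close> appends the leg, which suits the
  embedding \<open>X \<otimes> I_n\<close> of one level into the next.\<close>

definition tcons :: "(nat \<Rightarrow> nat \<Rightarrow> complex) \<Rightarrow> (nat list \<Rightarrow> nat list \<Rightarrow> complex) \<Rightarrow> nat list \<Rightarrow> nat list \<Rightarrow> complex" where
  "tcons d X is js = (if is \<noteq> [] \<and> js \<noteq> [] then d (hd is) (hd js) * X (tl is) (tl js) else 0)"

lemma elem_tensor_case_nat: "elem_tensor (Suc m) (case_nat d Y) is js = tcons d (elem_tensor m Y) is js"
  by (cases "is"; cases js) (simp_all add: tcons_def)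

lemma tcons_in_tensor_pow:
  assumes d: "d \<in> S" and X: "X \<in> tensor_pow m S"
  shows "tcons d X \<in> tensor_pow (Suc m) S"
  using X
proof (induction rule: tensor_pow_induct)
  case zero
  have "tcons d (\<lambda>is js. 0) = (\<lambda>is js. 0)" by (simp add: tcons_def fun_eq_iff)
  then show ?case by (simp add: zero_in_tensor_pow)
next
  case (add c Y X)
  have "case_nat d Y l \<in> S" if "l < Suc m" for l
    using that d add by (cases l) auto
  from elem_tensor_add_in_tensor_pow[where Y = "case_nat d Y" and c = c, OF add.IH this]
  have "(\<lambda>is js. c * tcons d (elem_tensor m Y) is js + tcons d X is js) \<in> tensor_pow (Suc m) S"
    by (simp add: elem_tensor_case_nat)
  moreover have "(\<lambda>is js. c * tcons d (elem_tensor m Y) is js + tcons d X is js) =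
      tcons d (\<lambda>is js. c * elem_tensor m Y is js + X is js)"
    by (simp add: fun_eq_iff tcons_def algebra_simps)
  ultimately show ?case by simp
qed

definition tsnoc :: "(nat list \<Rightarrow> nat list \<Rightarrow> complex) \<Rightarrow> (nat \<Rightarrow> nat \<Rightarrow> complex) \<Rightarrow> nat list \<Rightarrow> nat list \<Rightarrow> complex" where
  "tsnoc X d is js = (if is \<noteq> [] \<and> js \<noteq> [] then X (butlast is) (butlast js) * d (last is) (last js) else 0)"

lemma elem_tensor_upd: "elem_tensor (Suc m) (Y(m := d)) is js = tsnoc (elem_tensor m Y) d is js"
proof (cases "is = [] \<or> js = []")
  case False
  then obtain i is' j js' where [simp]: "is = is' @ [i]" "js = js' @ [j]"
    by (metis append_butlast_last_id)
  show ?thesis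
    by (auto simp: elem_tensor_def tsnoc_def nth_append intro!: prod.cong)
qed (auto simp: tsnoc_def)

lemma tsnoc_in_tensor_pow:
  assumes d: "d \<in> S" and X: "X \<in> tensor_pow m S"
  shows "tsnoc X d \<in> tensor_pow (Suc m) S"
  using X
proof (induction rule: tensor_pow_induct)
  case zero
  have "tsnoc (\<lambda>is js. 0) d = (\<lambda>is js. 0)" by (simp add: tsnoc_def fun_eq_iff)
  then show ?case by (simp add: zero_in_tensor_pow)
next
  case (add c Y X)
  have "(Y(m := d)) l \<in> S" if "l < Suc m" for l
    using that d add by (cases "l = m") auto
  from elem_tensor_add_in_tensor_pow[where Y = "Y(m := d)" and c = c, OF add.IH this]
  have "(\<lambda>is js. c * tsnoc (elem_tensor m Y) d is js + tsnoc X d is js) \<in> tensor_pow (Suc m) S"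
    by (simp add: elem_tensor_upd)
  moreover have "(\<lambda>is js. c * tsnoc (elem_tensor m Y) d is js + tsnoc X d is js) =
      tsnoc (\<lambda>is js. c * elem_tensor m Y is js + X is js) d"
    by (simp add: fun_eq_iff tsnoc_def algebra_simps)
  ultimately show ?case by simp
qed

text \<open>Expanding the first leg in a basis of \<open>S\<close> leaves coefficients that are
  slices of \<open>X\<close> and satisfy the same hypothesis on the remaining legs. Index lists of
  the wrong total length only yield the zero matrix.\<close>

lemma tensor_pow_if_slices:
  assumes S: "mat_star_subalg n S" and X: "X \<in> tmat_car n m"
    and slices: "\<And>u u' v v'. length u = length u' \<Longrightarrow> length v = length v' \<Longrightarrow>
      (\<lambda>i j. X (u @ i # v) (u' @ j # v')) \<in> S"
  shows "X \<in> tensor_pow m S"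
  using X slices
proof (induction m arbitrary: X)
  case 0
  then have "X = (\<lambda>is js. X [] [] * elem_tensor 0 undefined is js)"
    by (auto simp: fun_eq_iff elem_tensor_0 tmat_car_def idx_0)
  also have "\<dots> \<in> tensor_pow 0 S"
    by (intro scale_in_tensor_pow elem_tensor_in_tensor_pow) simp
  finally show ?case .
next
  case (Suc m)
  \<comment> \<open>Matrices become functions of a single index, a pair, as
    \<open>subspace_pivots\<close> requires.\<close>
  let ?T = "case_prod ` S"
  have "\<exists>P d. finite P \<and> (\<forall>p\<in>P. d p \<in> ?T) \<and> (\<forall>Z\<in>?T. \<forall>i. Z i = (\<Sum>p\<in>P. Z p * d p i))"
  proof (rule subspace_pivots[of "{..<n} \<times> {..<n}"])
    show "(\<lambda>i. 0) \<in> ?T"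
      using S by (intro image_eqI[of _ _ "\<lambda>i j. 0"]) (auto simp: mat_star_subalg_def)
  next
    fix Y Z assume "Y \<in> ?T" "Z \<in> ?T"
    then obtain Y' Z' where "Y' \<in> S" "Z' \<in> S" and [simp]: "Y = case_prod Y'" "Z = case_prod Z'" by blast
    then show "(\<lambda>i. Y i + Z i) \<in> ?T"
      using S by (intro image_eqI[of _ _ "\<lambda>i j. Y' i j + Z' i j"]) (auto simp: mat_star_subalg_def)
  next
    fix c Y assume "Y \<in> ?T"
    then obtain Y' where "Y' \<in> S" and [simp]: "Y = case_prod Y'" by blast
    then show "(\<lambda>i. c * Y i) \<in> ?T"
      using S by (intro image_eqI[of _ _ "\<lambda>i j. c * Y' i j"]) (auto simp: mat_star_subalg_def)
  next
    fix Z i assume "Z \<in> ?T" "i \<notin> {..<n} \<times> {..<n}"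
    then obtain Z' where "Z' \<in> mat_car n" and [simp]: "Z = case_prod Z'"
      using S unfolding mat_star_subalg_def by blast
    with \<open>i \<notin> _\<close> show "Z i = 0"
      by (auto simp: mat_car_def case_prod_unfold mem_Times_iff not_less)
  qed simp
  then obtain P d where "finite P" and d: "\<forall>p\<in>P. d p \<in> ?T"
    and exp': "\<forall>Z\<in>?T. \<forall>i. Z i = (\<Sum>p\<in>P. Z p * d p i)"
    by (elim exE conjE)
  have P: "curry (d p) \<in> S" if "p \<in> P" for p
    using d that by force
  have exp: "Z i j = (\<Sum>p\<in>P. Z (fst p) (snd p) * curry (d p) i j)" if "Z \<in> S" for Z i j
    using exp'[rule_format, OF imageI[OF that], of "(i, j)"] by (simp add: case_prod_unfold)
  \<comment> \<open>The coordinate at the pivot \<open>p\<close> is the entry there, so the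
    coefficient of the basis matrix \<open>d p\<close> is \<open>X\<close> with its first index pair
    frozen at \<open>p\<close>.\<close>
  define Z where "Z p is js = X (fst p # is) (snd p # js)" for p "is" js
  have "Z p \<in> tensor_pow m S" for p
  proof (rule Suc.IH)
    show "Z p \<in> tmat_car n m"
      using Suc.prems(1) by (force simp: Z_def tmat_car_def)
    fix u u' v v' :: "nat list" assume "length u = length u'" "length v = length v'"
    then show "(\<lambda>i j. Z p (u @ i # v) (u' @ j # v')) \<in> S"
      using Suc.prems(2)[of "fst p # u" "snd p # u'" v v'] by (simp add: Z_def)
  qed
  then have "(\<lambda>is js. \<Sum>p\<in>P. tcons (curry (d p)) (Z p) is js) \<in> tensor_pow (Suc m) S"
    by (intro sum_in_tensor_pow tcons_in_tensor_pow P)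
  moreover have "(\<Sum>p\<in>P. tcons (curry (d p)) (Z p) is js) = X is js" for "is" js
  proof (cases "length is = Suc m \<and> length js = Suc m")
    case True
    then obtain i is' j js' where [simp]: "is = i # is'" "js = j # js'" and "length is' = length js'"
      by (auto simp: length_Suc_conv)
    then have "(\<lambda>i j. X (i # is') (j # js')) \<in> S"
      using Suc.prems(2)[of "[]" "[]" is' js'] by simp
    from exp[OF this, of i j] show ?thesis
      by (simp add: tcons_def Z_def mult.commute)
  next
    case False
    then have "is' \<notin> idx n (Suc m) \<or> js' \<notin> idx n (Suc m)"
      if "length is' = length is" "length js' = length js" for is' js'
      using that by (auto simp: idx_def)
    then have zero: "X is' js' = 0" if "length is' = length is" "length js' = length js" for is' js'
      using that tmat_carD[OF Suc.prems(1)] by blast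
    then have "tcons (curry (d p)) (Z p) is js = 0" for p
      by (simp add: tcons_def Z_def)
    with zero show ?thesis by simp
  qed
  ultimately show ?case by simp
qed

section \<open>Iterating the isomorphism with matrices\<close>

locale cstar_mat = cstar cs st
  for cs :: "complex \<Rightarrow> 'b::{real_normed_algebra_1,banach}" and st :: "'b \<Rightarrow> 'b" +
  fixes n :: nat and \<psi> :: "'b \<Rightarrow> nat \<Rightarrow> nat \<Rightarrow> 'b"
  assumes psi: "star_iso_Mn cs st n \<psi>" and psi_1: "\<psi> 1 = mat_id n"
begin

abbreviation P where "P \<equiv> psi_pow \<psi>"

lemma psi_add: "\<psi> (x + y) i j = \<psi> x i j + \<psi> y i j"
  and psi_mult: "\<psi> (x * y) i j = (\<Sum>k<n. \<psi> x i k * \<psi> y k j)"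
  and psi_st: "\<psi> (st x) i j = st (\<psi> x j i)"
  and inj_psi: "inj \<psi>" and range_psi: "range \<psi> = mat_car n"
  using psi unfolding star_iso_Mn_def mmult_def by simp_all

lemma psi_cs_mult: "\<psi> (cs c * x) i j = cs c * \<psi> x i j"
proof -
  have "\<psi> (cs c * x) = (\<lambda>i j. cs c * \<psi> x i j)"
    using psi unfolding star_iso_Mn_def by blast
  then show ?thesis by simp
qed

lemma psi_0 [simp]: "\<psi> 0 i j = 0"
  using psi_add[of 0 0] by simp

lemma psi_outside: "n \<le> i \<or> n \<le> j \<Longrightarrow> \<psi> x i j = 0"
  using range_psi rangeI[of \<psi> x] by (auto simp: mat_car_def)

lemma psi_eqI: "(\<And>i j. i < n \<Longrightarrow> j < n \<Longrightarrow> \<psi> x i j = \<psi> y i j) \<Longrightarrow> x = y"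
  by (rule injD[OF inj_psi]) (metis ext not_less psi_outside)

lemma psi_cs: "\<psi> (cs c) i j = (if i = j \<and> i < n then cs c else 0)"
  using psi_cs_mult[of c 1] by (simp add: psi_1 mat_id_def)

text \<open>The definition adds the last leg, but as every leg comes from the same
  \<open>\<psi>\<close>, the first leg can be split off instead. The later inductions use this
  form.\<close>

lemma P_Cons: "P (Suc m) b (i # is) (j # js) = P m (\<psi> b i j) is js"
proof (induction m arbitrary: "is" js)
  case (Suc m)
  show ?case
  proof (cases "is = [] \<or> js = []")
    case False
    with Suc show ?thesis by (subst psi_pow.simps(2)) simp
  qed auto
qed auto

lemma P_Nil [simp]: "P (Suc m) b [] js = 0" "P (Suc m) b is [] = 0"
  by simp_all

declare psi_pow.simps(2) [simp del]
declare P_Cons [simp]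

lemma P_1: "P 1 b [i] [j] = \<psi> b i j"
  using P_Cons[of 0 b i "[]" j "[]"] by simp

lemma P_0 [simp]: "P m 0 is js = 0"
  by (induction m arbitrary: "is" js) (auto simp: psi_pow.simps(2))

lemma P_add: "P m (x + y) is js = P m x is js + P m y is js"
  by (induction m arbitrary: "is" js) (auto simp: psi_pow.simps(2) psi_add)

lemma P_sum: "P m (\<Sum>k\<in>I. f k) is js = (\<Sum>k\<in>I. P m (f k) is js)"
  by (induction I rule: infinite_finite_induct) (simp_all add: P_add)

lemma P_cs_mult: "P m (cs c * x) is js = cs c * P m x is js"
  by (induction m arbitrary: "is" js) (auto simp: psi_pow.simps(2) psi_cs_mult)

lemma P_st: "P m (st x) is js = st (P m x js is)"
  by (induction m arbitrary: "is" js) (auto simp: psi_pow.simps(2) psi_st)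

lemma P_mult: "P m (x * y) is js = tmult n m (P m x) (P m y) is js"
proof (induction m arbitrary: x y "is" js)
  case 0
  then show ?case by (simp add: tmult_def idx_0)
next
  case (Suc m)
  show ?case
  proof (cases "is = [] \<or> js = []")
    case True
    then show ?thesis by (auto simp: tmult_def)
  next
    case False
    then obtain i is' j js' where [simp]: "is = i # is'" "js = j # js'"
      by (auto simp: neq_Nil_conv)
    show ?thesis
      by (simp add: psi_mult P_sum Suc) (simp add: tmult_def sum_idx_Suc)
  qed
qed

lemma P_in_tmat_car: "P m b \<in> tmat_car n m"
proof -
  have "is \<in> idx n m \<and> js \<in> idx n m" if "P m b is js \<noteq> 0" for "is" js
    using that
  proof (induction m arbitrary: b "is" js)
    case 0
    then show ?case by (auto simp: idx_0 split: if_splits)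
  next
    case (Suc m)
    then obtain i is' j js' where [simp]: "is = i # is'" "js = j # js'"
      by (metis P_Nil neq_Nil_conv)
    have "P m (\<psi> b i j) is' js' \<noteq> 0" using Suc.prems by simp
    moreover from this have "\<psi> b i j \<noteq> 0" by auto
    then have "i < n \<and> j < n" using psi_outside by (meson not_less)
    ultimately show ?case using Suc.IH by simp
  qed
  then show ?thesis by (simp add: tmat_car_def)
qed

lemma P_cs: "P m (cs c) is js = (if is = js \<and> is \<in> idx n m then cs c else 0)"
proof (induction m arbitrary: "is" js)
  case 0
  then show ?case by (auto simp: idx_0)
next
  case (Suc m)
  show ?case
  proof (cases "is = [] \<or> js = []")
    case False
    then obtain i is' j js' where [simp]: "is = i # is'" "js = j # js'"
      by (auto simp: neq_Nil_conv)
    show ?thesis by (auto simp: psi_cs Suc)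
  qed auto
qed

lemma P_inj: "inj (P m)"
proof (induction m)
  case 0
  show ?case by (rule injI) (simp add: fun_eq_iff, metis)
next
  case (Suc m)
  show ?case
  proof (rule injI, rule psi_eqI)
    fix x y i j assume "P (Suc m) x = P (Suc m) y"
    then have "P m (\<psi> x i j) = P m (\<psi> y i j)"
      by (metis P_Cons ext)
    then show "\<psi> x i j = \<psi> y i j" by (rule injD[OF Suc])
  qed
qed

text \<open>A preimage is assembled blockwise: each block indexed by the first leg has a preimage by
  induction, and these form a matrix in the range of \<open>\<psi>\<close>. Hence \<open>inv\<close>
  is a genuine inverse on \<open>tmat_car\<close>.\<close>

lemma P_surj:
  assumes "X \<in> tmat_car n m"
  shows "\<exists>x. P m x = X"
  using assms
proof (induction m arbitrary: X)
  case 0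
  then have "P 0 (X [] []) = X"
    by (auto simp: fun_eq_iff tmat_car_def idx_0)
  then show ?case by blast
next
  case (Suc m)
  have "\<exists>b. P m b = (\<lambda>is js. X (i # is) (j # js))" for i j
    using Suc.prems by (intro Suc.IH) (force simp: tmat_car_def)
  then obtain b where b: "\<And>i j. P m (b i j) = (\<lambda>is js. X (i # is) (j # js))" by metis
  \<comment> \<open>Blocks outside the range are zero, and injectivity forces their chosen preimages
    to be zero as well.\<close>
  have "b \<in> mat_car n"
    unfolding mat_car_def
  proof (intro CollectI allI impI)
    fix i j assume "n \<le> i \<or> n \<le> j"
    then have "P m (b i j) = P m 0"
      using Suc.prems by (auto simp: b fun_eq_iff tmat_carD[of _ n "Suc m"])
    then show "b i j = 0" by (rule injD[OF P_inj])
  qed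
  then obtain x where x: "\<psi> x = b"
    using range_psi by (metis imageE)
  have "P (Suc m) x is js = X is js" for "is" js
    using Suc.prems by (cases "is"; cases js) (simp_all add: x b tmat_carD[of _ n "Suc m"])
  then show ?case by blast
qed

lemma P_inv: "X \<in> tmat_car n m \<Longrightarrow> P m (inv (P m) X) = X"
  using P_surj by (metis f_inv_into_f rangeI)

section \<open>The embeddings of the matrix algebras and their norms\<close>

abbreviation \<kappa> where "\<kappa> \<equiv> kappa cs \<psi>"

lemma P_kappa:
  assumes "X \<in> tmat_car n m"
  shows "P m (\<kappa> m X) is js = cs (X is js)"
proof -
  have "(\<lambda>is js. cs (X is js)) \<in> tmat_car n m"
    using assms by (auto simp: tmat_car_def) (metis cs_0)+
  from P_inv[OF this] show ?thesis by (simp add: kappa_def)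
qed

lemma kappa_eqI: "(\<And>is js. P m b is js = cs (X is js)) \<Longrightarrow> \<kappa> m X = b"
  unfolding kappa_def by (metis (no_types, lifting) P_inj ext inv_f_f)

lemma kappa_add: "X \<in> tmat_car n m \<Longrightarrow> Y \<in> tmat_car n m \<Longrightarrow> \<kappa> m (\<lambda>is js. X is js + Y is js) = \<kappa> m X + \<kappa> m Y"
  by (rule kappa_eqI) (simp add: P_add P_kappa cs_add)

lemma kappa_scale: "X \<in> tmat_car n m \<Longrightarrow> \<kappa> m (\<lambda>is js. c * X is js) = cs c * \<kappa> m X"
  by (rule kappa_eqI) (simp add: P_cs_mult P_kappa cs_mult)

lemma kappa_mult: "X \<in> tmat_car n m \<Longrightarrow> Y \<in> tmat_car n m \<Longrightarrow> \<kappa> m (tmult n m X Y) = \<kappa> m X * \<kappa> m Y"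
  by (rule kappa_eqI) (simp add: P_mult tmult_def P_kappa cs_mult cs_sum)

lemma kappa_star: "X \<in> tmat_car n m \<Longrightarrow> \<kappa> m (\<lambda>is js. cnj (X js is)) = st (\<kappa> m X)"
  by (rule kappa_eqI) (simp add: P_st P_kappa)

text \<open>Since \<open>\<psi>\<close> is unital, appending an identity leg does not change the
  image, so the images of the \<open>\<kappa> m\<close> increase with \<open>m\<close>.\<close>

lemma kappa_tsnoc: "X \<in> tmat_car n m \<Longrightarrow> \<kappa> (Suc m) (tsnoc X (mat_id n)) = \<kappa> m X"
  by (rule kappa_eqI) (simp add: psi_pow.simps(2) P_kappa psi_cs tsnoc_def mat_id_def)

text \<open>\<open>X\<close> is expanded in matrix units, with coefficients at most
  \<open>M\<close>. The constant \<open>K\<close> is the sum of the norms of their images and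
  depends on \<open>m\<close> but not on \<open>X\<close>.\<close>

lemma norm_kappa_le_const:
  "\<exists>K. \<forall>X M. X \<in> tmat_car n m \<longrightarrow> op_bound (idx n m) X M \<longrightarrow> norm (\<kappa> m X) \<le> K * M"
proof -
  define E :: "nat list \<Rightarrow> nat list \<Rightarrow> nat list \<Rightarrow> nat list \<Rightarrow> complex"
    where "E is js ks ls = (if is = ks \<and> js = ls then 1 else 0)" for "is" js ks ls
  define K where "K = (\<Sum>is\<in>idx n m. \<Sum>js\<in>idx n m. norm (\<kappa> m (E is js)))"
  have "norm (\<kappa> m X) \<le> K * M" if X: "X \<in> tmat_car n m" and M: "op_bound (idx n m) X M" for X M
  proof -
    have E: "E is js \<in> tmat_car n m" if "is \<in> idx n m" "js \<in> idx n m" for "is" js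
      using that by (auto simp: E_def tmat_car_def)
    have "\<kappa> m X = (\<Sum>is\<in>idx n m. \<Sum>js\<in>idx n m. cs (X is js) * \<kappa> m (E is js))"
    proof (rule kappa_eqI)
      fix ks ls
      have "P m (\<Sum>is\<in>idx n m. \<Sum>js\<in>idx n m. cs (X is js) * \<kappa> m (E is js)) ks ls =
          (\<Sum>is\<in>idx n m. \<Sum>js\<in>idx n m. cs (X is js * E is js ks ls))"
        by (simp add: P_sum P_cs_mult P_kappa E cs_mult)
      also have "\<dots> = (\<Sum>is\<in>idx n m. \<Sum>js\<in>idx n m. if js = ls then if is = ks then cs (X is js) else 0 else 0)"
        by (intro sum.cong refl) (simp add: E_def)
      also have "\<dots> = cs (X ks ls)"
        using X by (cases "ls \<in> idx n m") (simp_all add: tmat_carD)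
      finally show "P m (\<Sum>is\<in>idx n m. \<Sum>js\<in>idx n m. cs (X is js) * \<kappa> m (E is js)) ks ls = cs (X ks ls)" .
    qed
    also have "norm \<dots> \<le> (\<Sum>is\<in>idx n m. \<Sum>js\<in>idx n m. norm (\<kappa> m (E is js)) * M)"
      using op_bound_entry[OF M]
      by (intro sum_norm_le) (auto simp: norm_cs_mult mult.commute[of _ M] intro!: mult_right_mono)
    finally show ?thesis by (simp add: K_def sum_distrib_right)
  qed
  then show ?thesis by blast
qed

text \<open>A constant bound on the norm of \<open>\<kappa>\<close> improves to a contraction by applying it to the powers
  \<open>(X\<^sup>* X)^(2^k)\<close>, on which the C*-identity makes the norm multiplicative.\<close>

lemma norm_kappa_le:
  assumes X: "X \<in> tmat_car n m" and M: "op_bound (idx n m) X M"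
    and M': "op_bound (idx n m) (\<lambda>is js. cnj (X js is)) M"
  shows "norm (\<kappa> m X) \<le> M"
proof -
  obtain K where K: "\<And>X M. X \<in> tmat_car n m \<Longrightarrow> op_bound (idx n m) X M \<Longrightarrow> norm (\<kappa> m X) \<le> K * M"
    using norm_kappa_le_const[of m] by metis
  \<comment> \<open>Passing from \<open>Y\<close> to its square squares both the bound
    \<open>L\<close> and, by self-adjointness, the norm, which accounts for the doubling of the
    exponent.\<close>
  have pow: "norm (\<kappa> m Y) ^ (2 ^ k) \<le> K * L ^ (2 ^ k)"
    if "Y \<in> tmat_car n m" "op_bound (idx n m) Y L" "st (\<kappa> m Y) = \<kappa> m Y" for Y L k
    using that
  proof (induction k arbitrary: Y L)
    case 0
    then show ?case using K[of Y L] by simp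
  next
    case (Suc k)
    have "norm (\<kappa> m (tmult n m Y Y)) ^ (2 ^ k) \<le> K * (L * L) ^ (2 ^ k)"
    proof (rule Suc.IH)
      show "tmult n m Y Y \<in> tmat_car n m" using Suc.prems by (intro tmult_in_tmat_car)
      show "op_bound (idx n m) (tmult n m Y Y) (L * L)"
        unfolding tmult_def using Suc.prems by (intro op_bound_mult)
      show "st (\<kappa> m (tmult n m Y Y)) = \<kappa> m (tmult n m Y Y)"
        using Suc.prems by (simp add: kappa_mult st_mult)
    qed
    moreover have "norm (\<kappa> m (tmult n m Y Y)) = (norm (\<kappa> m Y))\<^sup>2"
      using norm_st_mult[of "\<kappa> m Y"] Suc.prems by (simp add: kappa_mult)
    ultimately show ?case
      by (simp only: power_Suc power_mult power2_eq_square)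
  qed
  define Y where "Y = tmult n m (\<lambda>is js. cnj (X js is)) X"
  have X': "(\<lambda>is js. cnj (X js is)) \<in> tmat_car n m"
    using X by (auto simp: tmat_car_def)
  have kY: "\<kappa> m Y = st (\<kappa> m X) * \<kappa> m X"
    unfolding Y_def kappa_mult[OF X' X] kappa_star[OF X] ..
  have "norm (\<kappa> m Y) \<le> M * M"
  proof (rule le_if_power_le)
    have "Y \<in> tmat_car n m" unfolding Y_def by (intro tmult_in_tmat_car X X')
    moreover have "op_bound (idx n m) Y (M * M)"
      unfolding Y_def tmult_def by (intro op_bound_mult M M')
    ultimately show "norm (\<kappa> m Y) ^ (2 ^ k) \<le> K * (M * M) ^ (2 ^ k)" for k
      by (rule pow) (simp add: kY st_mult)
  next
    show "0 \<le> M * M" by simp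
  qed simp
  then have "(norm (\<kappa> m X))\<^sup>2 \<le> M\<^sup>2"
    unfolding kY norm_st_mult power2_eq_square[of M] .
  then show ?thesis
    by (rule power2_le_imp_le) (rule conjunct1[OF M[unfolded op_bound_def]])
qed

section \<open>The shifts in coordinates\<close>

lemma P_shift:
  "P (Suc m) (shift \<psi> n (Suc m) b) (is @ [i]) (js @ [j]) = (if i = j \<and> i < n then P m b is js else 0)"
proof -
  let ?X = "\<lambda>is js. if is \<noteq> [] \<and> js \<noteq> [] \<and> last is = last js \<and> last is < n
              then P m b (butlast is) (butlast js) else 0"
  have "is \<in> idx n (Suc m) \<and> js \<in> idx n (Suc m)" if "?X is js \<noteq> 0" for "is" js
  proof -
    have nz: "is \<noteq> []" "js \<noteq> []" "last is = last js" "last is < n" "P m b (butlast is) (butlast js) \<noteq> 0"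
      using that by (auto split: if_splits)
    obtain is' i js' j where [simp]: "is = is' @ [i]" "js = js' @ [j]"
      using nz(1,2) by (meson rev_exhaust)
    show ?thesis using nz P_in_tmat_car[of m b] by (auto simp: idx_def tmat_car_def)
  qed
  then have "?X \<in> tmat_car n (Suc m)" unfolding tmat_car_def by blast
  from P_inv[OF this] have "P (Suc m) (shift \<psi> n (Suc m) b) = ?X"
    unfolding shift_def diff_Suc_1 .
  then show ?thesis by simp
qed

lemma psi_shift_1: "\<psi> (shift \<psi> n 1 b) i j = (if i = j \<and> i < n then b else 0)"
  using P_shift[of 0 b "[]" i "[]" j] by simp

text \<open>In two legs, \<open>\<sigma>_2\<close> inserts the identity at the second leg and keeps
  \<open>\<psi> b\<close> in the first leg and the coefficients.\<close>

lemma psi_psi_shift_2: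
  "\<psi> (\<psi> (shift \<psi> n 2 b) i j) k l = (if k = l \<and> k < n then \<psi> b i j else 0)"
  using P_shift[of 1 b "[i]" k "[j]" l] by (simp add: P_1 numeral_2_eq_2)

text \<open>Since \<open>S\<close> contains the identity, two elements of the union can be moved to
  a common level, where \<open>\<kappa>\<close> respects all operations. The algebraic properties,
  and commutativity, then pass to the closure.\<close>

lemma star_subalg_Dinf:
  assumes S: "mat_star_subalg n S" and one: "mat_id n \<in> S"
  shows "star_subalg cs st (Dinf cs \<psi> S)" (is ?sub)
    and "(\<And>X Y. X \<in> S \<Longrightarrow> Y \<in> S \<Longrightarrow> mmult n X Y = mmult n Y X) \<Longrightarrow> abelian_set (Dinf cs \<psi> S)"
proof -
  let ?U = "\<Union>m\<in>{1..}. \<kappa> m ` tensor_pow m S"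
  have car: "tensor_pow m S \<subseteq> tmat_car n m" for m
    using S by (intro tensor_pow_subset_tmat_car) (simp add: mat_star_subalg_def)
  have lift: "\<exists>Y\<in>tensor_pow (m + k) S. \<kappa> (m + k) Y = \<kappa> m X" if "X \<in> tensor_pow m S" for X m k
  proof (induction k)
    case (Suc k)
    then obtain Y where Y: "Y \<in> tensor_pow (m + k) S" "\<kappa> (m + k) Y = \<kappa> m X" by blast
    then have "\<kappa> (Suc (m + k)) (tsnoc Y (mat_id n)) = \<kappa> m X"
      using car by (subst kappa_tsnoc) auto
    moreover have "tsnoc Y (mat_id n) \<in> tensor_pow (Suc (m + k)) S"
      using Y one by (intro tsnoc_in_tensor_pow)
    ultimately show ?case by auto
  qed (use that in auto)
  have U: "\<kappa> m X \<in> ?U" if "1 \<le> m" "X \<in> tensor_pow m S" for m X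
    using that by blast
  have common: "\<exists>m\<ge>1. \<exists>X\<in>tensor_pow m S. \<exists>Y\<in>tensor_pow m S. x = \<kappa> m X \<and> y = \<kappa> m Y"
    if x: "x \<in> ?U" and y: "y \<in> ?U" for x y
  proof -
    obtain m X where m: "1 \<le> m" "X \<in> tensor_pow m S" "x = \<kappa> m X" using x by auto
    obtain k Y where k: "1 \<le> k" "Y \<in> tensor_pow k S" "y = \<kappa> k Y" using y by auto
    obtain X' where "X' \<in> tensor_pow (m + k) S" "\<kappa> (m + k) X' = x" using lift[OF m(2), of k] m(3) by blast
    moreover obtain Y' where "Y' \<in> tensor_pow (m + k) S" "\<kappa> (m + k) Y' = y"
      using lift[OF k(2), of m] k(3) by (auto simp: add.commute)
    ultimately show ?thesis using m(1) by (intro exI[of _ "m + k"]) auto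
  qed
  have "star_subalg cs st ?U"
    unfolding star_subalg_def
  proof (intro conjI ballI allI)
    have "\<kappa> 1 (\<lambda>is js. 0) = 0" by (rule kappa_eqI) simp
    then show "0 \<in> ?U" using U[OF order_refl zero_in_tensor_pow] by simp
    fix x assume x: "x \<in> ?U"
    then obtain m X where m: "1 \<le> m" and X: "X \<in> tensor_pow m S" "x = \<kappa> m X" by auto
    have Xc: "X \<in> tmat_car n m" using X car by blast
    show "cs c * x \<in> ?U" for c
      using U[OF m scale_in_tensor_pow[OF X(1)]] unfolding kappa_scale[OF Xc] X(2) .
    have "(\<lambda>is js. cnj (X js is)) \<in> tensor_pow m S"
      using X S by (intro star_in_tensor_pow) (auto simp: mat_star_subalg_def)
    from U[OF m this] show "st x \<in> ?U"
      unfolding kappa_star[OF Xc] X(2) .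
    fix y assume "y \<in> ?U"
    from common[OF x this] obtain m X Y where m: "1 \<le> m" and XY: "X \<in> tensor_pow m S" "Y \<in> tensor_pow m S"
      and xy: "x = \<kappa> m X" "y = \<kappa> m Y" by blast
    have c: "X \<in> tmat_car n m" "Y \<in> tmat_car n m" using XY car by auto
    show "x + y \<in> ?U"
      using U[OF m add_in_tensor_pow[OF XY]] unfolding kappa_add[OF c] xy .
    have "tmult n m X Y \<in> tensor_pow m S"
      using XY S by (intro tmult_in_tensor_pow) (auto simp: mat_star_subalg_def)
    from U[OF m this] show "x * y \<in> ?U"
      unfolding kappa_mult[OF c] xy .
  qed
  then show ?sub unfolding Dinf_def by (rule star_subalg_closure)
  assume ab: "\<And>X Y. X \<in> S \<Longrightarrow> Y \<in> S \<Longrightarrow> mmult n X Y = mmult n Y X"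
  have "abelian_set ?U"
    unfolding abelian_set_def
  proof (intro ballI)
    fix x y assume "x \<in> ?U" "y \<in> ?U"
    from common[OF this] obtain m X Y where XY: "X \<in> tensor_pow m S" "Y \<in> tensor_pow m S"
      and [simp]: "x = \<kappa> m X" "y = \<kappa> m Y" by blast
    have c: "X \<in> tmat_car n m" "Y \<in> tmat_car n m" using XY car by auto
    have "tmult n m X Y = tmult n m Y X"
      using ab XY by (rule tensor_pow_commute)
    then show "x * y = y * x"
      using kappa_mult[OF c] kappa_mult[OF c(2,1)] by simp
  qed
  then show "abelian_set (Dinf cs \<psi> S)" unfolding Dinf_def by (rule abelian_set_closure)
qed

end

section \<open>The state and the contractions it induces\<close>

locale cstar_mat_state = cstar_mat cs st n \<psi>
  for cs :: "complex \<Rightarrow> 'b::{real_normed_algebra_1,banach}" and st :: "'b \<Rightarrow> 'b" and n \<psi> +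
  fixes \<phi> :: "'b \<Rightarrow> complex"
  assumes phi_1: "\<phi> 1 = 1" and phi_pc: "pos_contraction cs st \<phi>"
begin

lemma phi_add: "\<phi> (x + y) = \<phi> x + \<phi> y"
  and phi_cs_mult: "\<phi> (cs c * x) = c * \<phi> x"
  and phi_pos: "Im (\<phi> (st x * x)) = 0" "0 \<le> Re (\<phi> (st x * x))"
  using phi_pc by (simp_all add: pos_contraction_def)

lemma phi_0 [simp]: "\<phi> 0 = 0"
  using phi_add[of 0 0] by simp

lemma phi_cs [simp]: "\<phi> (cs c) = c"
  using phi_cs_mult[of c 1] by (simp add: phi_1)

lemma phi_sum: "\<phi> (\<Sum>k\<in>I. f k) = (\<Sum>k\<in>I. \<phi> (f k))"
  by (induction I rule: infinite_finite_induct) (simp_all add: phi_add)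

text \<open>\<open>\<phi>\<close> is real on \<open>st (y + 1) * (y + 1)\<close> and on
  \<open>st y * y\<close>, which leaves opposite imaginary parts at \<open>y\<close> and
  \<open>st y\<close>. Taking \<open>y = x\<close> and \<open>y = cs \<i> * x\<close> gives both
  components.\<close>

lemma phi_st: "\<phi> (st x) = cnj (\<phi> x)"
proof (rule complex_eqI)
  have *: "Im (\<phi> (st y)) + Im (\<phi> y) = 0" for y
  proof -
    have "st (y + 1) * (y + 1) = st y * y + (st y + (y + 1))"
      by (simp add: st_add algebra_simps)
    then show ?thesis
      using phi_pos(1)[of "y + 1"] phi_pos(1)[of y] by (simp add: phi_add phi_1)
  qed
  from *[of x] show "Im (\<phi> (st x)) = Im (cnj (\<phi> x))" by simp
  from *[of "cs \<i> * x"] show "Re (\<phi> (st x)) = Re (cnj (\<phi> x))"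
    by (simp add: st_cs_mult phi_cs_mult)
qed

text \<open>Positivity is applied to \<open>z\<close> minus the scalar
  \<open>\<phi> z\<close>.\<close>

lemma phi_Cauchy_Schwarz: "(cmod (\<phi> z))\<^sup>2 \<le> Re (\<phi> (st z * z))"
proof -
  let ?c = "\<phi> z"
  have "st (z + cs (- ?c)) * (z + cs (- ?c)) = st z * z + (cs (- ?c) * st z + (cs (- cnj ?c) * z + cs (cnj ?c * ?c)))"
    using cs_mult[of "- cnj ?c" "- ?c"]
    by (simp add: st_add distrib_left distrib_right cs_comm[of "- ?c" "st z"] add.assoc)
  then have "\<phi> (st (z + cs (- ?c)) * (z + cs (- ?c))) = \<phi> (st z * z) - cnj ?c * ?c"
    by (simp only: phi_add phi_cs_mult phi_cs phi_st) (simp add: algebra_simps)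
  then have "Re (\<phi> (st (z + cs (- ?c)) * (z + cs (- ?c)))) = Re (\<phi> (st z * z)) - (cmod ?c)\<^sup>2"
    using cmod_power2[of ?c] by (simp add: power2_eq_square)
  with phi_pos(2)[of "z + cs (- ?c)"] show ?thesis by simp
qed

text \<open>For a vector \<open>\<xi>\<close>, let \<open>\<omega> x\<close> be the inner product of
  \<open>\<xi>\<close> with the image of \<open>\<xi>\<close> under
  \<open>phi_pow \<phi> \<psi> m x\<close>. It is positive because
  \<open>\<omega> (st x * x)\<close> is a sum of values of \<open>\<phi>\<close> on squares, and
  \<open>\<omega> 1\<close> is the squared norm of \<open>\<xi>\<close>. Thus
  \<open>positive_functional_le\<close> bounds \<open>\<omega> (st b * b)\<close>, which by
  Cauchy-Schwarz dominates the squared norm of the image of \<open>\<xi>\<close> for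
  \<open>x = b\<close>.\<close>

lemma op_bound_phi_pow: "op_bound (idx n m) (phi_pow \<phi> \<psi> m b) (norm b)"
  unfolding op_bound_def
proof (intro conjI allI)
  fix \<xi> :: "nat list \<Rightarrow> complex"
  let ?I = "idx n m"
  define z where "z x k = (\<Sum>j\<in>?I. cs (\<xi> j) * P m x k j)" for x k
  define \<omega> where "\<omega> x = (\<Sum>i\<in>?I. \<Sum>j\<in>?I. cnj (\<xi> i) * \<xi> j * \<phi> (P m x i j))" for x
  have \<omega>_sq: "\<omega> (st x * x) = (\<Sum>k\<in>?I. \<phi> (st (z x k) * z x k))" for x
  proof -
    have st_sum: "st (\<Sum>i\<in>?I. f i) = (\<Sum>i\<in>?I. st (f i))" for f
      using linear_sum[OF bounded_linear.linear[OF bounded_linear_st]] .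
    have "\<phi> (st (z x k) * z x k) = (\<Sum>i\<in>?I. \<Sum>j\<in>?I. cnj (\<xi> i) * \<xi> j * \<phi> (st (P m x k i) * P m x k j))" for k
      by (simp add: z_def st_sum st_cs_mult sum_product cs_mult_cs_mult phi_sum phi_cs_mult)
    moreover have "\<omega> (st x * x) = (\<Sum>i\<in>?I. \<Sum>j\<in>?I. \<Sum>k\<in>?I. cnj (\<xi> i) * \<xi> j * \<phi> (st (P m x k i) * P m x k j))"
      by (simp add: \<omega>_def P_mult tmult_def P_st phi_sum sum_distrib_left)
    moreover have "\<dots> = (\<Sum>i\<in>?I. \<Sum>k\<in>?I. \<Sum>j\<in>?I. cnj (\<xi> i) * \<xi> j * \<phi> (st (P m x k i) * P m x k j))"
      by (intro sum.cong refl sum.swap)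
    moreover have "\<dots> = (\<Sum>k\<in>?I. \<Sum>i\<in>?I. \<Sum>j\<in>?I. cnj (\<xi> i) * \<xi> j * \<phi> (st (P m x k i) * P m x k j))"
      by (rule sum.swap)
    ultimately show ?thesis by simp
  qed
  have "Re (\<omega> (st b * b)) \<le> (norm b)\<^sup>2 * Re (\<omega> 1)"
  proof (rule positive_functional_le)
    show "\<omega> (x + y) = \<omega> x + \<omega> y" for x y
      by (simp add: \<omega>_def P_add phi_add distrib_left sum.distrib)
    show "\<omega> (cs c * x) = c * \<omega> x" for c x
      by (simp add: \<omega>_def P_cs_mult phi_cs_mult sum_distrib_left mult_ac)
    show "0 \<le> Re (\<omega> (st x * x))" for x
      by (simp add: \<omega>_sq phi_pos sum_nonneg)
  qed
  moreover have "\<omega> 1 = (\<Sum>i\<in>?I. complex_of_real ((cmod (\<xi> i))\<^sup>2))"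
  proof -
    have "\<omega> 1 = (\<Sum>i\<in>?I. \<Sum>j\<in>?I. if i = j then cnj (\<xi> i) * \<xi> j else 0)"
      unfolding \<omega>_def using P_cs[of m 1] by (intro sum.cong) (auto simp: phi_1)
    also have "\<dots> = (\<Sum>i\<in>?I. complex_of_real ((cmod (\<xi> i))\<^sup>2))"
      by (intro sum.cong refl) (simp only: complex_norm_square, simp add: mult.commute)
    finally show ?thesis .
  qed
  moreover have "(\<Sum>i\<in>?I. (cmod (\<Sum>j\<in>?I. phi_pow \<phi> \<psi> m b i j * \<xi> j))\<^sup>2) \<le> Re (\<omega> (st b * b))"
  proof -
    have "(\<Sum>j\<in>?I. phi_pow \<phi> \<psi> m b i j * \<xi> j) = \<phi> (z b i)" for i
      by (simp add: z_def phi_pow_def phi_sum phi_cs_mult mult.commute)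
    then show ?thesis
      by (simp add: \<omega>_sq sum_mono phi_Cauchy_Schwarz)
  qed
  ultimately show "(\<Sum>i\<in>?I. (cmod (\<Sum>j\<in>?I. phi_pow \<phi> \<psi> m b i j * \<xi> j))\<^sup>2)
      \<le> (norm b)\<^sup>2 * (\<Sum>i\<in>?I. (cmod (\<xi> i))\<^sup>2)"
    by simp
qed simp

lemma phi_pow_in_tmat_car: "phi_pow \<phi> \<psi> m b \<in> tmat_car n m"
  using P_in_tmat_car[of m b] unfolding phi_pow_def tmat_car_def mem_Collect_eq by (metis phi_0)

text \<open>The adjoint of \<open>phi_pow \<phi> \<psi> m b\<close> belongs to \<open>st b\<close>,
  which has the same norm, so both bounds required by \<open>norm_kappa_le\<close> hold.\<close>

lemma norm_kappa_phi_pow_le: "norm (\<kappa> m (phi_pow \<phi> \<psi> m b)) \<le> norm b"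
proof (rule norm_kappa_le)
  have "(\<lambda>is js. cnj (phi_pow \<phi> \<psi> m b js is)) = phi_pow \<phi> \<psi> m (st b)"
    by (simp add: phi_pow_def P_st phi_st)
  then show "op_bound (idx n m) (\<lambda>is js. cnj (phi_pow \<phi> \<psi> m b js is)) (norm b)"
    using op_bound_phi_pow[of m "st b"] by simp
qed (rule phi_pow_in_tmat_car op_bound_phi_pow)+

lemma kappa_phi_pow_add:
  "\<kappa> m (phi_pow \<phi> \<psi> m (x + y)) = \<kappa> m (phi_pow \<phi> \<psi> m x) + \<kappa> m (phi_pow \<phi> \<psi> m y)"
  using kappa_add[OF phi_pow_in_tmat_car[of m x] phi_pow_in_tmat_car[of m y]]
  by (simp add: phi_pow_def P_add phi_add)

lemma kappa_phi_pow_kappa: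
  assumes "X \<in> tmat_car n m"
  shows "\<kappa> m (phi_pow \<phi> \<psi> m (\<kappa> m X)) = \<kappa> m X"
  by (rule kappa_eqI) (simp add: phi_pow_def P_kappa[OF assms])

text \<open>An additive contraction that fixes a point near \<open>b\<close> moves \<open>b\<close>
  by at most twice the distance to that point; hence the choice \<open>e / 2\<close>.\<close>

lemma Calg_approx:
  assumes "b \<in> Calg cs \<psi> n" "0 < e"
  shows "\<exists>m\<ge>1. dist (\<kappa> m (phi_pow \<phi> \<psi> m b)) b < e"
proof -
  obtain m X where m: "1 \<le> m" and X: "X \<in> tmat_car n m" and d: "dist (\<kappa> m X) b < e / 2"
    using assms(1)[unfolded Calg_def closure_approachable, rule_format, OF half_gt_zero[OF assms(2)]] by auto
  have "\<kappa> m (phi_pow \<phi> \<psi> m b) = \<kappa> m (phi_pow \<phi> \<psi> m (b - \<kappa> m X)) + \<kappa> m X"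
    using kappa_phi_pow_add[of m "b - \<kappa> m X" "\<kappa> m X"] X by (simp add: kappa_phi_pow_kappa)
  then have "dist (\<kappa> m (phi_pow \<phi> \<psi> m b)) b = norm (\<kappa> m (phi_pow \<phi> \<psi> m (b - \<kappa> m X)) - (b - \<kappa> m X))"
    by (simp add: dist_norm algebra_simps)
  also have "\<dots> \<le> norm (b - \<kappa> m X) + norm (b - \<kappa> m X)"
    using norm_triangle_ineq4 norm_kappa_phi_pow_le by (rule order_trans[OF _ add_right_mono])
  also have "\<dots> < e" using d by (simp add: dist_norm norm_minus_commute)
  finally show ?thesis using m by blast
qed

end

section \<open>The maximal abelian subalgebra\<close>

locale cstar_mat_masa = cstar_mat_state cs st n \<psi> \<phi>
  for cs :: "complex \<Rightarrow> 'b::{real_normed_algebra_1,banach}" and st :: "'b \<Rightarrow> 'b" and n \<psi> \<phi> +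
  fixes A :: "'b set"
  assumes A: "masa_in cs st UNIV A"
    and shift_1: "shift \<psi> n 1 ` A \<subseteq> A"
    and shift_2: "shift \<psi> n 2 ` A \<subseteq> A"
    and phi_A_mult: "\<And>a b. a \<in> A \<Longrightarrow> b \<in> A \<Longrightarrow> \<phi> (a * b) = \<phi> a * \<phi> b"
begin

definition D :: "(nat \<Rightarrow> nat \<Rightarrow> complex) set" where
  "D = (\<lambda>a i j. \<phi> (\<psi> a i j)) ` A"

lemma A_subalg: "0 \<in> A" "x \<in> A \<Longrightarrow> y \<in> A \<Longrightarrow> x + y \<in> A" "x \<in> A \<Longrightarrow> y \<in> A \<Longrightarrow> x * y \<in> A"
    "x \<in> A \<Longrightarrow> cs c * x \<in> A" "x \<in> A \<Longrightarrow> st x \<in> A"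
  and A_commute: "x \<in> A \<Longrightarrow> y \<in> A \<Longrightarrow> x * y = y * x"
  using A by (simp_all add: masa_in_def star_subalg_def abelian_set_def)

lemma one_in_A: "1 \<in> A"
  by (rule commutant_masa[OF A]) simp

text \<open>In matrix form the first shift of \<open>b\<close> is \<open>I_n \<otimes> b\<close>.
  Its commuting with \<open>a\<close> says, entry by entry, that \<open>b\<close> commutes with
  \<open>\<psi> a i j\<close>.\<close>

lemma psi_in_A:
  assumes a: "a \<in> A"
  shows "\<psi> a i j \<in> A"
proof (cases "i < n \<and> j < n")
  case True
  show ?thesis
  proof (rule commutant_masa[OF A])
    fix b assume "b \<in> A"
    then have "shift \<psi> n 1 b \<in> A" using shift_1 by blast
    then have "shift \<psi> n 1 b * a = a * shift \<psi> n 1 b"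
      using a by (rule A_commute)
    then have "\<psi> (shift \<psi> n 1 b * a) i j = \<psi> (a * shift \<psi> n 1 b) i j" by simp
    moreover have "\<psi> (shift \<psi> n 1 b * a) i j = (\<Sum>k<n. if i = k then b * \<psi> a k j else 0)"
      unfolding psi_mult psi_shift_1 using True by (intro sum.cong) auto
    moreover have "\<psi> (a * shift \<psi> n 1 b) i j = (\<Sum>k<n. if k = j then \<psi> a i k * b else 0)"
      unfolding psi_mult psi_shift_1 using True by (intro sum.cong) auto
    ultimately show "b * \<psi> a i j = \<psi> a i j * b"
      using True by simp
  qed
next
  case False
  then have "\<psi> a i j = 0" by (intro psi_outside) auto
  then show ?thesis by (simp add: A_subalg(1))
qed

text \<open>The second shift of \<open>b\<close> has the identity in the second leg. Freezing that
  leg at \<open>(k, l)\<close> in its commutation relation with \<open>a\<close> gives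
  \<open>b * a' = a' * b\<close>, where \<open>a'\<close> is the element whose matrix is the
  slice.\<close>

lemma slice_in_A:
  assumes a: "a \<in> A"
  shows "\<exists>a'\<in>A. \<forall>i j. \<psi> a' i j = \<psi> (\<psi> a i j) k l"
proof (cases "k < n \<and> l < n")
  case True
  have "(\<lambda>i j. \<psi> (\<psi> a i j) k l) \<in> mat_car n"
    by (auto simp: mat_car_def psi_outside)
  then obtain a' where a': "\<psi> a' = (\<lambda>i j. \<psi> (\<psi> a i j) k l)"
    using range_psi by (metis imageE)
  have "a' \<in> A"
  proof (rule commutant_masa[OF A], rule psi_eqI)
    fix b i j assume b: "b \<in> A"
    define s where "s = shift \<psi> n 2 b"
    have "s \<in> A" using b shift_2 by (auto simp: s_def)
    then have "\<psi> (\<psi> (s * a) i j) k l = \<psi> (\<psi> (a * s) i j) k l"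
      using A_commute[OF _ a, of s] by simp
    moreover have "\<psi> (\<psi> (s * a) i j) k l = (\<Sum>p<n. \<psi> (\<psi> s i p * \<psi> a p j) k l)"
      using P_sum[of 1 _ "{..<n}" "[k]" "[l]"] by (simp add: psi_mult P_1)
    moreover have "\<psi> (\<psi> (a * s) i j) k l = (\<Sum>p<n. \<psi> (\<psi> a i p * \<psi> s p j) k l)"
      using P_sum[of 1 _ "{..<n}" "[k]" "[l]"] by (simp add: psi_mult P_1)
    moreover have "\<psi> (\<psi> s i p * \<psi> a p j) k l = \<psi> b i p * \<psi> a' p j" for p
    proof -
      have "\<psi> (\<psi> s i p * \<psi> a p j) k l = (\<Sum>q<n. if k = q then \<psi> b i p * \<psi> (\<psi> a p j) q l else 0)"
        unfolding psi_mult s_def psi_psi_shift_2 using True by (intro sum.cong) auto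
      then show ?thesis using True by (simp add: a')
    qed
    moreover have "\<psi> (\<psi> a i p * \<psi> s p j) k l = \<psi> a' i p * \<psi> b p j" for p
    proof -
      have "\<psi> (\<psi> a i p * \<psi> s p j) k l = (\<Sum>q<n. if q = l then \<psi> (\<psi> a i p) k q * \<psi> b p j else 0)"
        unfolding psi_mult s_def psi_psi_shift_2 using True by (intro sum.cong) auto
      then show ?thesis using True by (simp add: a')
    qed
    ultimately show "\<psi> (b * a') i j = \<psi> (a' * b) i j"
      by (simp add: psi_mult)
  qed
  then show ?thesis by (rule bexI[rotated]) (simp add: a')
next
  case False
  then have "\<forall>i j. \<psi> 0 i j = \<psi> (\<psi> a i j) k l" by (auto simp: psi_outside)
  then show ?thesis using A_subalg(1) by blast
qed

text \<open>Each index pair in \<open>v\<close> and \<open>v'\<close> is absorbed by one use of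
  \<open>slice_in_A\<close>. If their length differs from \<open>m\<close>, the entries vanish and
  \<open>a' = 0\<close> serves.\<close>

lemma slices_in_A:
  assumes "length v = length v'" "a \<in> A"
  shows "\<exists>a'\<in>A. \<forall>i j. P m (\<psi> a i j) v v' = \<psi> a' i j"
  using assms
proof (induction v v' arbitrary: m a rule: list_induct2)
  case Nil
  show ?case
  proof (cases m)
    case 0
    then show ?thesis using Nil by auto
  next
    case (Suc k)
    then show ?thesis using A_subalg(1) by (intro bexI[of _ 0]) auto
  qed
next
  case (Cons k v l v')
  show ?case
  proof (cases m)
    case 0
    then show ?thesis using A_subalg(1) by (intro bexI[of _ 0]) auto
  next
    case (Suc p)
    obtain a' where "a' \<in> A" "\<And>i j. \<psi> a' i j = \<psi> (\<psi> a i j) k l"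
      using slice_in_A[OF Cons.prems] by blast
    with Cons.IH[of a' p] show ?thesis by (simp add: Suc)
  qed
qed

section \<open>The matrix algebra obtained from \<open>A\<close>\<close>

lemma zero_in_D: "(\<lambda>i j. 0) \<in> D"
  unfolding D_def using A_subalg(1) by (intro image_eqI[of _ _ 0]) auto

text \<open>Index pairs before the free leg replace \<open>a\<close> by an entry of
  \<open>\<psi> a\<close>, still in \<open>A\<close>; those after it are absorbed by
  \<open>slices_in_A\<close>. The free leg that remains gives an element of
  \<open>D\<close>.\<close>

lemma phi_pow_slice_in_D:
  assumes "length u = length u'" "length v = length v'" "a \<in> A"
  shows "(\<lambda>i j. phi_pow \<phi> \<psi> m a (u @ i # v) (u' @ j # v')) \<in> D"
  using assms(1,3)
proof (induction u u' arbitrary: m a rule: list_induct2)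
  case Nil
  show ?case
  proof (cases m)
    case 0
    then show ?thesis by (simp add: phi_pow_def zero_in_D)
  next
    case (Suc k)
    obtain a' where "a' \<in> A" "\<And>i j. P k (\<psi> a i j) v v' = \<psi> a' i j"
      using slices_in_A[OF assms(2) Nil] by blast
    then show ?thesis by (auto simp: Suc phi_pow_def D_def)
  qed
next
  case (Cons x u y u')
  show ?case
  proof (cases m)
    case 0
    then show ?thesis by (simp add: phi_pow_def zero_in_D)
  next
    case (Suc k)
    then show ?thesis
      using Cons.IH[of "\<psi> a x y" k] psi_in_A[OF Cons.prems] by (simp add: phi_pow_def)
  qed
qed

lemma mat_star_subalg_D: "mat_star_subalg n D"
  unfolding mat_star_subalg_def
proof (intro conjI ballI allI)
  show "D \<subseteq> mat_car n"
    by (auto simp: D_def mat_car_def psi_outside)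
  show "(\<lambda>i j. 0) \<in> D" by (rule zero_in_D)
  fix X assume "X \<in> D"
  then obtain a where a: "a \<in> A" and [simp]: "X = (\<lambda>i j. \<phi> (\<psi> a i j))"
    by (auto simp: D_def)
  show "(\<lambda>i j. c * X i j) \<in> D" for c
    unfolding D_def using A_subalg(4)[OF a, of c]
    by (rule rev_image_eqI) (simp add: psi_cs_mult phi_cs_mult)
  show "(\<lambda>i j. cnj (X j i)) \<in> D"
    unfolding D_def using A_subalg(5)[OF a]
    by (rule rev_image_eqI) (simp add: psi_st phi_st)
  fix Y assume "Y \<in> D"
  then obtain b where b: "b \<in> A" and [simp]: "Y = (\<lambda>i j. \<phi> (\<psi> b i j))"
    by (auto simp: D_def)
  show "(\<lambda>i j. X i j + Y i j) \<in> D"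
    unfolding D_def using A_subalg(2)[OF a b]
    by (rule rev_image_eqI) (simp add: psi_add phi_add)
  \<comment> \<open>Multiplicativity of \<open>\<phi>\<close> is known on \<open>A\<close> only; it
    applies because all entries of \<open>\<psi> a\<close> and \<open>\<psi> b\<close> lie in
    \<open>A\<close>.\<close>
  show "mmult n X Y \<in> D"
    unfolding D_def using A_subalg(3)[OF a b]
    by (rule rev_image_eqI) (simp add: psi_mult phi_sum phi_A_mult psi_in_A a b mmult_def)
qed

lemma D_commute:
  assumes "X \<in> D" "Y \<in> D"
  shows "mmult n X Y = mmult n Y X"
proof -
  obtain a b where ab: "a \<in> A" "b \<in> A" and XY: "X = (\<lambda>i j. \<phi> (\<psi> a i j))" "Y = (\<lambda>i j. \<phi> (\<psi> b i j))"
    using assms by (auto simp: D_def)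
  have "mmult n X Y = (\<lambda>i j. \<phi> (\<psi> (a * b) i j))"
    by (simp add: XY psi_mult phi_sum phi_A_mult psi_in_A ab mmult_def)
  also have "a * b = b * a" by (rule A_commute[OF ab])
  also have "(\<lambda>i j. \<phi> (\<psi> (b * a) i j)) = mmult n Y X"
    by (simp add: XY psi_mult phi_sum phi_A_mult psi_in_A ab mmult_def)
  finally show ?thesis .
qed

lemma mat_id_in_D: "mat_id n \<in> D"
  unfolding D_def using one_in_A
  by (rule rev_image_eqI) (auto simp: psi_1 mat_id_def fun_eq_iff phi_1)

section \<open>Comparison of the limit algebras and maximality\<close>

lemma A_Int_Calg_subset_Dinf: "A \<inter> Calg cs \<psi> n \<subseteq> Dinf cs \<psi> D"
proof
  fix b assume b: "b \<in> A \<inter> Calg cs \<psi> n"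
  have "phi_pow \<phi> \<psi> m b \<in> tensor_pow m D" for m
    using b by (intro tensor_pow_if_slices[OF mat_star_subalg_D phi_pow_in_tmat_car] phi_pow_slice_in_D) auto
  then have U: "\<kappa> m (phi_pow \<phi> \<psi> m b) \<in> (\<Union>m\<in>{1..}. \<kappa> m ` tensor_pow m D)" if "1 \<le> m" for m
    using that by blast
  show "b \<in> Dinf cs \<psi> D"
    unfolding Dinf_def closure_approachable
  proof (intro allI impI)
    fix e :: real assume "0 < e"
    with b obtain m where "1 \<le> m" "dist (\<kappa> m (phi_pow \<phi> \<psi> m b)) b < e"
      using Calg_approx by blast
    then show "\<exists>y\<in>\<Union>m\<in>{1..}. \<kappa> m ` tensor_pow m D. dist y b < e"
      using U by (intro bexI)
  qed
qed

text \<open>Allowing every abelian \<open>S\<close> above \<open>D\<close> lets one statement serve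
  twice: \<open>S = D\<close> identifies the intersection, and arbitrary \<open>S\<close> gives
  maximality of \<open>D\<close>.\<close>

lemma Dinf_eq:
  assumes max: "masa_in cs st (Calg cs \<psi> n) (A \<inter> Calg cs \<psi> n)"
    and S: "mat_star_subalg n S" "\<And>X Y. X \<in> S \<Longrightarrow> Y \<in> S \<Longrightarrow> mmult n X Y = mmult n Y X" and DS: "D \<subseteq> S"
  shows "Dinf cs \<psi> S = A \<inter> Calg cs \<psi> n"
proof -
  have "Dinf cs \<psi> D \<subseteq> Dinf cs \<psi> S"
    unfolding Dinf_def using tensor_pow_mono[OF DS] by (intro closure_mono) blast
  with A_Int_Calg_subset_Dinf have "A \<inter> Calg cs \<psi> n \<subseteq> Dinf cs \<psi> S" by blast
  moreover have "tensor_pow m S \<subseteq> tmat_car n m" for m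
    using S(1) by (intro tensor_pow_subset_tmat_car) (simp add: mat_star_subalg_def)
  then have "Dinf cs \<psi> S \<subseteq> Calg cs \<psi> n"
    unfolding Dinf_def Calg_def by (intro closure_mono UN_mono image_mono) auto
  moreover have "mat_id n \<in> S" using mat_id_in_D DS by blast
  ultimately show ?thesis
    using max star_subalg_Dinf[OF S(1)] S(2) unfolding masa_in_def by blast
qed

lemma mat_masa_D:
  assumes max: "masa_in cs st (Calg cs \<psi> n) (A \<inter> Calg cs \<psi> n)"
  shows "mat_masa n D"
  unfolding mat_masa_def
proof (intro conjI ballI allI impI)
  show "mat_star_subalg n D" by (rule mat_star_subalg_D)
  show "mmult n X Y = mmult n Y X" if "X \<in> D" "Y \<in> D" for X Y
    using that by (rule D_commute)
  fix S assume S: "D \<subseteq> S \<and> mat_star_subalg n S \<and> (\<forall>X\<in>S. \<forall>Y\<in>S. mmult n X Y = mmult n Y X)"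
  have "S \<subseteq> D"
  proof
    fix X assume X: "X \<in> S"
    \<comment> \<open>\<open>X\<close> viewed as a tensor with one leg. Its image under
      \<open>\<kappa> 1\<close> has the scalar matrix entries \<open>cs (X i j)\<close>, so applying
      \<open>\<phi>\<close> entrywise returns \<open>X\<close> and exhibits it in
      \<open>D\<close>.\<close>
    let ?E = "elem_tensor 1 (\<lambda>_. X)"
    have "?E \<in> tensor_pow 1 S" using X by (intro elem_tensor_in_tensor_pow)
    then have "\<kappa> 1 ?E \<in> Dinf cs \<psi> S"
      unfolding Dinf_def by (intro subsetD[OF closure_subset]) auto
    then have in_A: "\<kappa> 1 ?E \<in> A" using Dinf_eq[OF max, of S] S by blast
    have "?E \<in> tmat_car n 1"
      using X S by (intro elem_tensor_in_tmat_car) (auto simp: mat_star_subalg_def)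
    then have "P 1 (\<kappa> 1 ?E) [i] [j] = cs (X i j)" for i j
      by (simp only: P_kappa) (simp add: elem_tensor_def)
    then have "\<psi> (\<kappa> 1 ?E) i j = cs (X i j)" for i j by (simp only: P_1)
    then show "X \<in> D"
      unfolding D_def using in_A by (intro image_eqI[of _ _ "\<kappa> 1 ?E"]) simp_all
  qed
  with S show "S = D" by blast
qed

end

theorem theorem3p10:
  fixes cs :: "complex \<Rightarrow> 'b::{real_normed_algebra_1,banach}"
    and st :: "'b \<Rightarrow> 'b"
    and n :: nat
    and \<psi> :: "'b \<Rightarrow> nat \<Rightarrow> nat \<Rightarrow> 'b"
    and A :: "'b set"
    and \<phi> :: "'b \<Rightarrow> complex"
    and D :: "(nat \<Rightarrow> nat \<Rightarrow> complex) set"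
  assumes B: "cstar_alg cs st"
    and psi: "star_iso_Mn cs st n \<psi>"
    and psi1: "\<psi> 1 = mat_id n"
    and A: "masa_in cs st UNIV A"
    and sig1: "shift \<psi> n 1 ` A \<subseteq> A"
    and sig2: "shift \<psi> n 2 ` A \<subseteq> A"
    and phi_hom: "\<phi> 1 = 1" "\<forall>a\<in>A. \<forall>b\<in>A. \<phi> (a * b) = \<phi> a * \<phi> b"
    and phi_pc: "pos_contraction cs st \<phi>"
    and D: "D = (\<lambda>a i j. phi_pow \<phi> \<psi> 1 a [i] [j]) ` A"
    and AC: "masa_in cs st (Calg cs \<psi> n) (A \<inter> Calg cs \<psi> n)"
  shows "A \<inter> Calg cs \<psi> n = Dinf cs \<psi> D \<and> mat_masa n D"
proof -
  interpret M: cstar_mat_masa cs st n \<psi> \<phi> A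
    by unfold_locales (use assms in auto)
  have "D = M.D"
    unfolding D M.D_def phi_pow_def M.P_1 ..
  then show ?thesis
    using M.Dinf_eq[OF AC M.mat_star_subalg_D M.D_commute] M.mat_masa_D[OF AC] by simp
qed

end
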